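(* Let $f$ be a pairwise loss such that for all $z,z'\in\mathcal{Z}$ the map $\mathbf{w}\mapsto f(\mathbf{w};z,z')$ is convex and $G$-Lipschitz on $\mathcal{W}$. Let $\beta\in(0,1)$, $\epsilon>0$, $\delta\in(0,1)$, and let $\sigma^2=\frac{56G^2T}{\beta n^2\epsilon}\big(\frac{\log(1/\delta)}{(1-\beta)\epsilon}+1\big)$ be the noise variance of Algorithm 2 (described in the context) run for $T$ iterations on a dataset of size $n$. Set $\lambda=\frac{\log(1/\delta)}{(1-\beta)\epsilon}+1$. If $\sigma^2\ge2.68G^2$ and $$\lambda-1\le\frac{\sigma^2}{6G^2}\log\Big(\frac{n}{2\lambda\big(1+\frac{\sigma^2}{4G^2}\big)}\Big),$$ then Algorithm 2 satisfies $(\epsilon,\delta)$-differential privacy.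
   Context: Data space $\mathcal{Z}=\mathcal{X}\times\mathcal{Y}$, $\mathcal{X}\subset\mathbb{R}^d$, $\mathcal{Y}\subset\mathbb{R}$; $\mathcal{W}\subseteq\mathbb{R}^d$ convex; pairwise loss $f:\mathcal{W}\times\mathcal{Z}\times\mathcal{Z}\to\mathbb{R}$ with (sub)gradient $\partial f(\mathbf{w};z,z')$ in $\mathbf{w}$. $G$-Lipschitz means $|f(\mathbf{w};z,z')-f(\mathbf{w}';z,z')|\le G\|\mathbf{w}-\mathbf{w}'\|_2$. Algorithm 2 (DP-SGD for pairwise learning): input dataset $S=\{z_1,\dots,z_n\}$, step sizes $\{\eta_t\}$, $\epsilon,\delta,\beta,G,T$. Set $\mathbf{w}_1=\mathbf{0}$. For $t=1,\dots,T$: sample $(i_t,j_t)$ uniformly over all ordered pairs $\{(i,j):i,j\in[n],i\ne j\}$, draw $\mathbf{b}_t\sim\mathcal{N}(0,\sigma^2\mathbf{I}_d)$ with $\sigma^2=\frac{56G^2T}{\beta n^2\epsilon}\big(\frac{\log(1/\delta)}{(1-\beta)\epsilon}+1\big)$ (all independent), and set $\mathbf{w}_{t+1}=\mathrm{Proj}_{\mathcal{W}}(\mathbf{w}_t-\eta_t(\partial f(\mathbf{w}_t;z_{i_t},z_{j_t})+\mathbf{b}_t))$. Output $\mathbf{w}_{\mathrm{priv}}=\frac1T\sum_{t=1}^T\mathbf{w}_t$. A randomized algorithm $\mathcal{A}$ is $(\epsilon,\delta)$-differentially private if for any two datasets $S,S'$ of size $n$ differing in exactly one data point and any measurable event $E$,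 $\mathbb{P}(\mathcal{A}(S)\in E)\le e^\epsilon\mathbb{P}(\mathcal{A}(S')\in E)+\delta$.
   Formalization: The (sub)gradients used are assumed to have norm at most G on all of W (at boundary points of W this does not follow from G-Lipschitzness, and privacy can then fail); W is also assumed closed and to contain 0, and the (sub)gradient to be measurable in w. *)

theory Defs
  imports "HOL-Analysis.Analysis" "HOL-Probability.Probability"
begin

definition gauss_noise :: "real \<Rightarrow> 'a::euclidean_space measure" where
  "gauss_noise s2 =
     density lborel (\<lambda>x. ennreal (\<Prod>b\<in>Basis. normal_density 0 (sqrt s2) (x \<bullet> b)))"

definition ordered_pairs :: "nat \<Rightarrow> (nat \<times> nat) set" where
  "ordered_pairs n = {(i, j). i < n \<and> j < n \<and> i \<noteq> j}"

definition dpsgd_step ::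
  "'a::euclidean_space set \<Rightarrow> ('a \<Rightarrow> 'z \<Rightarrow> 'z \<Rightarrow> 'a) \<Rightarrow> (nat \<Rightarrow> real) \<Rightarrow> real
     \<Rightarrow> 'z list \<Rightarrow> nat \<Rightarrow> 'a \<Rightarrow> 'a measure" where
  "dpsgd_step W g eta s2 S t w =
     bind (measure_pmf (pmf_of_set (ordered_pairs (length S))))
       (\<lambda>(i, j). bind (gauss_noise s2)
          (\<lambda>b. return borel (closest_point W (w - eta t *\<^sub>R (g w (S ! i) (S ! j) + b)))))"

text \<open>Distribution of the state after k iterations:
  (w_{k+1}, w_1 + ... + w_k), starting from w_1 = 0.\<close>
primrec dpsgd_traj ::
  "'a::euclidean_space set \<Rightarrow> ('a \<Rightarrow> 'z \<Rightarrow> 'z \<Rightarrow> 'a) \<Rightarrow> (nat \<Rightarrow> real) \<Rightarrow> real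
     \<Rightarrow> 'z list \<Rightarrow> nat \<Rightarrow> ('a \<times> 'a) measure" where
  "dpsgd_traj W g eta s2 S 0 = return borel (0, 0)"
| "dpsgd_traj W g eta s2 S (Suc k) =
     bind (dpsgd_traj W g eta s2 S k)
       (\<lambda>(w, acc). distr (dpsgd_step W g eta s2 S (Suc k) w) borel (\<lambda>w'. (w', acc + w)))"

definition dpsgd :: 
  "'a::euclidean_space set \<Rightarrow> ('a \<Rightarrow> 'z \<Rightarrow> 'z \<Rightarrow> 'a) \<Rightarrow> (nat \<Rightarrow> real) \<Rightarrow> real
     \<Rightarrow> 'z list \<Rightarrow> nat \<Rightarrow> 'a measure" where
  "dpsgd W g eta s2 S T =
     distr (dpsgd_traj W g eta s2 S T) borel (\<lambda>(w, acc). (1 / real T) *\<^sub>R acc)"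

definition neighbouring :: "nat \<Rightarrow> 'z list \<Rightarrow> 'z list \<Rightarrow> bool" where
  "neighbouring n S S' \<longleftrightarrow> length S = n \<and> length S' = n \<and>
     card {i. i < n \<and> S ! i \<noteq> S' ! i} = 1"

definition differentially_private ::
  "('z list \<Rightarrow> 'b measure) \<Rightarrow> 'z set \<Rightarrow> nat \<Rightarrow> real \<Rightarrow> real \<Rightarrow> bool" where
  "differentially_private A Z n eps delta \<longleftrightarrow>
     (\<forall>S S'. set S \<subseteq> Z \<longrightarrow> set S' \<subseteq> Z \<longrightarrow> neighbouring n S S' \<longrightarrow>
        (\<forall>E \<in> sets (A S). measure (A S) E \<le> exp eps * measure (A S') E + delta))"

end

(*
Say that Q dominates P with constant c if the integral of f under P is at most c times the
L^\<beta>(Q) norm of f for all measurable f with values in [0,1], where \<beta> is conjugate to \<alpha>. This is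
the dual form of a bound on the Renyi divergence of order \<alpha>, and it needs no densities: it passes
to image measures and multiplies along kernel compositions, so the projections and the accumulation of the
iterates cost nothing and only a single noisy gradient has to be analysed. At order \<alpha> = lam the
T-fold product gives the divergence bound \<beta> \<epsilon> and the passage to (\<epsilon>, \<delta>) costs (1 - \<beta>) \<epsilon>.

For one step, the pairs avoiding the changed index m carry mass 1 - p with p = 2/n. Coupling each
of them with each pair containing m reduces the step to two mixtures P = (1 - p) A + p B and
Q = (1 - p) A + p B' of Gaussians whose centres are at distance at most 2 G. The moment of P/Q is
expanded to second order around 1; the remainder is p^2 (B - B')^2 / Q times max 1 (P/Q)^(\<alpha> - 2),
and the hypothesis on lam says precisely that \<alpha> p exp (3 s (\<alpha> - 1) / 2) \<le> s / (1 + s) for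
s = 4 G^2 / \<sigma>^2, which keeps the contribution of large likelihood ratios of order s.
*)
theory Submission
  imports Defs
begin

subsection \<open>Elementary inequalities\<close>

text \<open>The constants serve one budget. With \<open>p = 2 / n\<close> and
  \<open>s = 4 * G\<^sup>2 / \<sigma>sq\<close>, the number 56 is 3.5 * 4 * 4, and since the
  remainder enters the moment with the factor \<alpha> (\<alpha> - 1) p^2 / 2, its integral may be
  at most 7 s. Its chi-square part costs at most 2 (exp s - exp (s/2)), the value for centres that
  form an equilateral triangle of maximal side; the bound 2.68 keeps s below 1.4926, where this is
  less than 3.5 s. The obstacle is the factor (P/Q)^(\<alpha> - 2): the Gaussian moment of order
  \<alpha> may be as large as exp (\<alpha> (\<alpha> - 1) s / 2). Every power of the ratio brings a
  factor p / (1 - p), however, and the condition on lam makes p small enough, exponentially in s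
  (\<alpha> - 1), to win from order 3 on. Smaller orders are separate: up to 2 the ratio factor can
  be avoided altogether, and between 2 and 3 it is concave.\<close>

lemma exp_le_quadratic:
  fixes x :: real
  assumes "0 \<le> x" "x \<le> 0.75"
  shows "exp x \<le> 1 + x + 0.7 * x\<^sup>2"
proof -
  obtain t where t: "\<bar>t\<bar> \<le> \<bar>x\<bar>" and e: "exp x = (\<Sum>m<4. x ^ m / fact m) + exp t / fact 4 * x ^ 4"
    using Maclaurin_exp_le[of x 4] by auto
  have "exp t \<le> exp 1" using t assms by simp
  then have et: "exp t \<le> 3" using exp_le by linarith
  have e': "exp x = 1 + x + x\<^sup>2/2 + x^3/6 + exp t / 24 * x^4"
    unfolding e by (simp add: eval_nat_numeral field_simps)
  have "x^3 \<le> 0.75 * x\<^sup>2" using mult_right_mono[OF assms(2), of "x\<^sup>2"] by (simp add: eval_nat_numeral)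
  moreover have "x^4 \<le> (0.75 * 0.75) * x\<^sup>2"
    using mult_right_mono[OF mult_mono[OF assms(2) assms(2)], of "x\<^sup>2"] assms by (simp add: eval_nat_numeral)
  moreover have "exp t / 24 * x^4 \<le> 3/24 * x^4"
    using et by (intro mult_right_mono) auto
  \<comment> \<open>The coefficients add up to about 0.6953. The range up to 0.75 accommodates s/2
    for s up to 1.4926.\<close>
  ultimately have "exp x \<le> 1 + x + (1/2 + 0.75/6 + 3/24*0.75*0.75) * x\<^sup>2" unfolding e'
    by (simp add: algebra_simps)
  also have "\<dots> \<le> 1 + x + 0.7 * x\<^sup>2"
    by (intro add_left_mono mult_right_mono) auto
  finally show ?thesis .
qed

text \<open>The left side bounds every chi-square integral below, and 1.4926 lies just above 4 /
  2.68. The excess over s is kept quadratic because for large orders it is paid for by the factor 1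
  / (1 + s) of the sampling condition.\<close>

lemma exp_gap_le:
  fixes s :: real
  assumes "0 \<le> s" "s \<le> 1.4926"
  shows "2 * (exp s - exp (s/2)) \<le> s + 1.51 * s\<^sup>2"
proof -
  define x m where "x = s/2" and "m = exp x"
  have x: "0 \<le> x" "x \<le> 0.7463" using assms by (auto simp: x_def)
  have m: "m \<le> 1 + x + 0.7 * x\<^sup>2" "1 \<le> m" using exp_le_quadratic[of x] x by (auto simp: m_def)
  have "exp s = m * m" unfolding m_def x_def by (simp flip: exp_add)
  then have "2 * (exp s - exp (s/2)) = 2 * (m * (m - 1))" by (simp add: m_def x_def algebra_simps)
  also have "\<dots> \<le> 2 * ((1 + x + 0.7 * x\<^sup>2) * (x + 0.7 * x\<^sup>2))"
    using m x by (intro mult_left_mono mult_mono) auto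
  also have "\<dots> = 2*x + 3.4 * x\<^sup>2 + (2.8 * x + 0.98 * (x * x)) * x\<^sup>2"
    by (simp add: eval_nat_numeral algebra_simps)
  also have "\<dots> \<le> 2*x + 3.4 * x\<^sup>2 + (2.8 * 0.7463 + 0.98 * (0.7463 * 0.7463)) * x\<^sup>2"
    using x by (intro add_left_mono mult_right_mono add_mono mult_left_mono mult_mono) auto
  also have "\<dots> \<le> 2*x + 6.04 * x\<^sup>2" by (simp add: algebra_simps)
  also have "\<dots> = s + 1.51 * s\<^sup>2" by (simp add: x_def power2_eq_square)
  finally show ?thesis .
qed

text \<open>If X, Y, Z are the squared sides of the triangle of centres over the variance, the left
  side is the integral of (B - B')^2 / A. The extremal case is X = Y = Z = s: in the variables a =
  exp (X/2) and b = exp (Y/2), products and squares are replaced by affine bounds that are exact at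
  a = b = m, which leaves a function increasing in a + b.\<close>

lemma exp_two_point_le:
  fixes X Y Z s :: real
  assumes "0 \<le> X" "X \<le> s" "0 \<le> Y" "Y \<le> s" "Z \<le> s"
  shows "exp X + exp Y - 2 * exp ((X + Y - Z)/2) \<le> 2 * (exp s - exp (s/2))"
proof -
  define a b m where "a = exp (X/2)" and "b = exp (Y/2)" and "m = exp (s/2)"
  have ab: "1 \<le> a" "a \<le> m" "1 \<le> b" "b \<le> m" using assms by (auto simp: a_def b_def m_def)
  have m0: "0 < m" by (simp add: m_def)
  have e: "exp X = a * a" "exp Y = b * b" "exp s = m * m"
    by (simp_all add: a_def b_def m_def flip: exp_add)
  have "a * b / m = exp ((X + Y - s)/2)"
    by (simp add: a_def b_def m_def diff_divide_distrib add_divide_distrib exp_add exp_diff)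
  also have "\<dots> \<le> exp ((X + Y - Z)/2)" using assms by simp
  finally have 1: "a * b / m \<le> exp ((X + Y - Z)/2)" .
  have "0 \<le> (m - a) * (m - b)" using ab by simp
  then have "m * (a + b - m) \<le> a * b" by (simp add: algebra_simps)
  then have 2: "a + b - m \<le> a * b / m" using m0 by (simp add: field_simps)
  have "0 \<le> (a - 1) * (m - a)" "0 \<le> (b - 1) * (m - b)" using ab by simp_all
  then have 3: "a * a \<le> (1 + m) * a - m" "b * b \<le> (1 + m) * b - m" by (simp_all add: algebra_simps)
  have "exp X + exp Y - 2 * exp ((X + Y - Z)/2) \<le> (m - 1) * (a + b)"
    using 1 2 3 unfolding e by (simp add: algebra_simps)
  also have "\<dots> \<le> (m - 1) * (m + m)" using ab by (intro mult_left_mono add_mono) auto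
  also have "\<dots> = 2 * (exp s - exp (s/2))" unfolding e by (simp add: m_def algebra_simps)
  finally show ?thesis .
qed

lemma powr_le_affine:
  fixes v t :: real
  assumes "0 < v" "0 \<le> t" "t \<le> 1"
  shows "v powr t \<le> 1 + t * (v - 1)"
  using Youngs_inequality_0[of t "1 - t" v 1] assms by (simp add: algebra_simps)

text \<open>Below order 2 a Lagrange remainder would contain a negative power. Splitting off one
  factor v and linearising the concave rest gives a global bound instead, at the price of a factor 2
  / \<alpha> in the quadratic coefficient.\<close>

lemma powr_le_quadratic:
  fixes v \<alpha> :: real
  assumes "0 < v" "1 \<le> \<alpha>" "\<alpha> \<le> 2"
  shows "v powr \<alpha> \<le> 1 + \<alpha> * (v - 1) + (\<alpha> - 1) * (v - 1)\<^sup>2"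
proof -
  have "v powr \<alpha> = v * v powr (\<alpha> - 1)"
    using assms powr_add[of v 1 "\<alpha> - 1"] by simp
  also have "\<dots> \<le> v * (1 + (\<alpha> - 1) * (v - 1))"
    using assms by (intro mult_left_mono powr_le_affine) auto
  also have "\<dots> = 1 + \<alpha> * (v - 1) + (\<alpha> - 1) * (v - 1)\<^sup>2"
    by (simp add: power2_eq_square algebra_simps)
  finally show ?thesis .
qed

text \<open>Lagrange remainder at 1: the intermediate point is at most \<open>max 1 v\<close>, and
  its exponent \<alpha> - 2 is nonnegative. The point v = 1 is separate because the Lagrange form
  needs a point different from the centre of expansion.\<close>

lemma powr_le_Taylor:
  fixes v \<alpha> :: real
  assumes "0 < v" "2 \<le> \<alpha>"
  shows "v powr \<alpha> \<le> 1 + \<alpha> * (v - 1) + \<alpha> * (\<alpha> - 1) / 2 * (v - 1)\<^sup>2 * max 1 v powr (\<alpha> - 2)"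
proof (cases "v = 1")
  case False
  define d where "d = (\<lambda>k::nat. \<lambda>t::real. if k = 0 then t powr \<alpha> else if k = 1 then \<alpha> * t powr (\<alpha> - 1)
    else \<alpha> * (\<alpha> - 1) * t powr (\<alpha> - 2))"
  have der: "\<forall>m t. m < 2 \<and> min v 1 \<le> t \<and> t \<le> max v 1 \<longrightarrow> DERIV (d m) t :> d (Suc m) t"
  proof (intro allI impI)
    fix m :: nat and t :: real
    assume A: "m < 2 \<and> min v 1 \<le> t \<and> t \<le> max v 1"
    then have t: "0 < t" using assms by (auto simp: min_def split: if_splits)
    from A consider "m = 0" | "m = 1" by linarith
    then show "DERIV (d m) t :> d (Suc m) t"
    proof cases
      case 1 then show ?thesis unfolding d_def using t
        by (auto intro!: derivative_eq_intros)
    next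
      case 2 then show ?thesis unfolding d_def using t
        by (auto intro!: derivative_eq_intros simp: field_simps)
    qed
  qed
  obtain t where t: "if v < 1 then v < t \<and> t < 1 else 1 < t \<and> t < v"
    and e: "d 0 v = (\<Sum>m<2. (d m 1 / fact m) * (v - 1)^m) + (d 2 t / fact 2) * (v - 1)^2"
    using Taylor[of 2 d "d 0" "min v 1" "max v 1" 1 v, OF _ _ der] False by auto
  have t': "0 < t" "t \<le> max 1 v" using t assms by (auto split: if_splits)
  have "v powr \<alpha> = 1 + \<alpha> * (v - 1) + \<alpha> * (\<alpha> - 1) / 2 * (v - 1)\<^sup>2 * t powr (\<alpha> - 2)"
    using e by (simp add: d_def numeral_2_eq_2 mult_ac)
  also have "\<dots> \<le> 1 + \<alpha> * (v - 1) + \<alpha> * (\<alpha> - 1) / 2 * (v - 1)\<^sup>2 * max 1 v powr (\<alpha> - 2)"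
    using t' assms by (intro add_left_mono mult_left_mono powr_mono2) auto
  finally show ?thesis .
qed simp

text \<open>Here u will be a multiple of the likelihood ratio L = B / A and r = \<alpha> - 2.
  Separating u from its r-th power means that, after multiplication by L^2 A, only Gaussian moments
  of the orders 3 and \<alpha> occur.\<close>

lemma one_plus_powr_le:
  fixes u r :: real
  assumes "0 \<le> u" "1 \<le> r"
  shows "(1 + u) powr r \<le> 1 + exp 1 * (r * u + (r * u) powr r)"
proof -
  \<comment> \<open>Bernoulli's inequality (1 - u / (1 + u))^r >= 1 - r u / (1 + u), obtained from
    the concave case with exponent 1 / r at the point (1 + u)^(- r).\<close>
  have "((1 + u) powr (- r)) powr (1 / r) = (1 + u) powr (- 1)"
    unfolding powr_powr using assms by simp
  then have "1 / (1 + u) = ((1 + u) powr (- r)) powr (1 / r)"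
    using assms by (simp add: powr_minus_divide)
  also have "\<dots> \<le> 1 + 1 / r * ((1 + u) powr (- r) - 1)"
    using assms by (intro powr_le_affine) auto
  finally have "r * (1 / (1 + u) - 1) \<le> (1 + u) powr (- r) - 1"
    using assms by (simp add: field_simps)
  also have "1 / (1 + u) - 1 = - (u / (1 + u))"
    using assms by (simp add: field_simps)
  finally have "(1 - r * (u / (1 + u))) * (1 + u) powr r \<le> (1 + u) powr (- r) * (1 + u) powr r"
    by (intro mult_right_mono) auto
  also have "\<dots> = 1" using assms by (simp flip: powr_add)
  finally have "(1 + u) powr r \<le> 1 + r * u * ((1 + u) powr r / (1 + u))"
    by (simp add: algebra_simps)
  also have "(1 + u) powr r / (1 + u) = (1 + u) powr (r - 1)"
    using assms by (simp add: powr_diff)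
  finally have 1: "(1 + u) powr r \<le> 1 + r * u * (1 + u) powr (r - 1)" .
  have inv_r: "(1 + 1 / r) powr (r - 1) \<le> exp 1"
  proof -
    have "(r - 1) * ln (1 + 1 / r) \<le> (r - 1) * (1 / r)"
      using assms by (intro mult_left_mono ln_add_one_self_le_self) auto
    also have "\<dots> \<le> 1" using assms by (simp add: field_simps)
    finally show ?thesis using assms by (simp add: powr_def)
  qed
  \<comment> \<open>For r u \<le> 1 the base is at most 1 + 1/r, and otherwise at most (1 + 1/r) r
    u. Either way the surplus (1 + 1/r)^(r - 1) is at most e.\<close>
  have 2: "(1 + u) powr (r - 1) \<le> exp 1 * (1 + (r * u) powr (r - 1))"
  proof (cases "r * u \<le> 1")
    case True
    then have "(1 + u) powr (r - 1) \<le> (1 + 1 / r) powr (r - 1)"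
      using assms by (intro powr_mono2) (auto simp: field_simps)
    with inv_r have "(1 + u) powr (r - 1) \<le> exp 1 * 1" by simp
    also have "\<dots> \<le> exp 1 * (1 + (r * u) powr (r - 1))" by (intro mult_left_mono) auto
    finally show ?thesis .
  next
    case False
    then have "(1 + u) powr (r - 1) \<le> ((1 + 1 / r) * (r * u)) powr (r - 1)"
      using assms by (intro powr_mono2) (auto simp: field_simps)
    also have "\<dots> = (1 + 1 / r) powr (r - 1) * (r * u) powr (r - 1)"
      using assms by (simp add: powr_mult)
    also have "\<dots> \<le> exp 1 * (1 + (r * u) powr (r - 1))"
      using inv_r by (intro mult_mono) auto
    finally show ?thesis .
  qed
  have "r * u * (1 + u) powr (r - 1) \<le> r * u * (exp 1 * (1 + (r * u) powr (r - 1)))"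
    using assms by (intro mult_left_mono 2) auto
  also have "\<dots> = exp 1 * (r * u + r * u * (r * u) powr (r - 1))"
    by (simp add: algebra_simps)
  also have "r * u * (r * u) powr (r - 1) = (r * u) powr r"
    using assms by (cases "u = 0") (auto simp: powr_diff)
  finally show ?thesis using 1 by simp
qed

section \<open>Numerical budget for the second-order remainder\<close>

lemma exp_three_halves_le:
  fixes s :: real
  assumes "0 \<le> s" "s \<le> 1.4926"
  shows "exp (1.5 * s) \<le> 5 * (1 + s)"
proof -
  define x m where "x = s/2" and "m = exp x"
  have x: "0 \<le> x" "x \<le> 0.7463" using assms by (auto simp: x_def)
  have "x\<^sup>2 \<le> 0.7463 * x" using mult_right_mono[OF x(2) x(1)] by (simp add: power2_eq_square)
  then have m: "m \<le> 1 + 1.5225 * x" "0 \<le> m"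
    using exp_le_quadratic[of x] x by (auto simp: m_def)
  then have m2: "m \<le> 2.1363" using x by simp
  have "exp (1.5 * s) = m * m * m" unfolding m_def x_def by (simp flip: exp_add)
  also have "\<dots> \<le> 2.1363 * 2.1363 * (1 + 1.5225 * x)"
    using m m2 by (intro mult_mono) auto
  also have "\<dots> \<le> 5 * (1 + s)" using assms by (simp add: x_def algebra_simps)
  finally show ?thesis .
qed

text \<open>The left side of the sampling condition increases with the order, so it may be evaluated
  at any smaller order 1 + \<gamma>. The choices \<gamma> = 1 and \<gamma> = 2 yield numerical
  bounds on p that are uniform in \<alpha>.\<close>

lemma sampling_rate_le:
  fixes s p \<alpha> \<gamma> :: real
  assumes "0 < s" "0 < p" "p < 1" "1 + \<gamma> \<le> \<alpha>" "0 \<le> \<gamma>"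
    and cond: "\<alpha> * p * exp (1.5 * s * (\<alpha> - 1)) \<le> s / (1 + s)"
  shows "(1 + \<gamma>) * p * exp (1.5 * s * \<gamma>) * (1 + s) \<le> s"
proof -
  have "(1 + \<gamma>) * p * exp (1.5 * s * \<gamma>) \<le> \<alpha> * p * exp (1.5 * s * (\<alpha> - 1))"
    using assms by (intro mult_mono) auto
  with cond have "(1 + \<gamma>) * p * exp (1.5 * s * \<gamma>) \<le> s / (1 + s)" by linarith
  then show ?thesis using assms by (simp add: field_simps)
qed

text \<open>The left side bounds the integral of the remainder at these orders. The outer 1 / (1 -
  p) stems from Q >= (1 - p) A, the inner one from P / Q \<le> 1 + p / (1 - p) * (B / A).\<close>

lemma moment_budget_le_3:
  fixes s p \<alpha> :: real
  assumes s: "0 < s" "s \<le> 1.4926" and p: "0 < p" "p < 1" and \<alpha>: "2 < \<alpha>" "\<alpha> \<le> 3"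
    and cond: "\<alpha> * p * exp (1.5 * s * (\<alpha> - 1)) \<le> s / (1 + s)"
  shows "(2 * (exp s - exp (s/2)) + (\<alpha> - 2) * (p / (1 - p)) * exp (3 * s)) / (1 - p) \<le> 7 * s"
proof -
  have "2 * p * exp (1.5 * s) * (1 + s) \<le> s"
    using sampling_rate_le[of s p 1 \<alpha>] assms by simp
  moreover have "2 * p * (1 + 1.5 * s) * (1 + s) \<le> 2 * p * exp (1.5 * s) * (1 + s)"
    using s p by (intro mult_mono) auto
  \<comment> \<open>The quotient s / ((1 + 1.5 s) (1 + s)) peaks at sqrt (2/3) with a value of about
    0.202; hence the square around 0.8.\<close>
  moreover have "s \<le> 0.204 * (1 + 1.5 * s) * (1 + s)"
  proof -
    have "0.204 * (1 + 1.5 * s) * (1 + s) - s = 0.306 * (s - 0.8)\<^sup>2 + (0.00816 - 0.0004 * s)"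
      by (simp add: power2_eq_square field_simps)
    also have "0 \<le> \<dots>" using s by (intro add_nonneg_nonneg) auto
    finally show ?thesis by (simp only: diff_ge_0_iff_ge)
  qed
  ultimately have "(2 * p) * ((1 + 1.5 * s) * (1 + s)) \<le> 0.204 * ((1 + 1.5 * s) * (1 + s))"
    unfolding mult.assoc by (meson order_trans)
  then have p_le: "p \<le> 0.102"
    using s by (subst (asm) mult_le_cancel_right_pos) auto
  have "1.5 * s * 1 \<le> 1.5 * s * (\<alpha> - 1)" using s \<alpha> by (intro mult_left_mono) auto
  \<comment> \<open>The condition provides exp (- 1.5 s (\<alpha> - 1)), which below order 3 does
    not outweigh exp (3 s). The missing factor is at most exp (1.5 s) \<le> 5 (1 + s), and this 1 +
    s cancels against the condition.\<close>
  then have le: "3 * s \<le> 1.5 * s * (\<alpha> - 1) + 1.5 * s" by linarith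
  have "p * exp (3 * s) \<le> p * exp (1.5 * s * (\<alpha> - 1)) * exp (1.5 * s)"
    using p le by (simp flip: exp_add)
  also have "\<dots> \<le> (s / (1 + s) / \<alpha>) * (5 * (1 + s))"
  proof (rule mult_mono)
    show "p * exp (1.5 * s * (\<alpha> - 1)) \<le> s / (1 + s) / \<alpha>"
      using cond \<alpha> by (subst pos_le_divide_eq) (simp_all add: mult_ac)
  qed (use s p \<alpha> exp_three_halves_le[of s] in auto)
  also have "\<dots> = 5 * s / \<alpha>"
  proof -
    have "x / w / \<alpha> * (5 * w) = 5 * x / \<alpha>" if "w \<noteq> 0" for x w :: real using that by simp
    from this[of "1 + s"] s show ?thesis by simp
  qed
  finally have "(\<alpha> - 2) * (p * exp (3 * s)) \<le> (\<alpha> - 2) * (5 * s / \<alpha>)"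
    using \<alpha> by (intro mult_left_mono) auto
  also have "\<dots> \<le> 5 / 3 * s"
  proof -
    have "(\<alpha> - 2) / \<alpha> \<le> 1 / 3" using \<alpha> by (simp add: field_simps)
    from mult_left_mono[OF this, of "5 * s"] s show ?thesis by (simp add: field_simps)
  qed
  finally have "(\<alpha> - 2) * (p * exp (3 * s)) / (1 - p) \<le> (5 / 3 * s) / (1 - p)"
    using p by (intro divide_right_mono) auto
  then have B: "(\<alpha> - 2) * (p / (1 - p)) * exp (3 * s) \<le> (5 / 3 * s) / (1 - p)" by simp
  have "2 * (exp s - exp (s/2)) \<le> s + 1.51 * s\<^sup>2" using exp_gap_le s by simp
  also have "s\<^sup>2 \<le> 1.4926 * s" using s by (simp add: power2_eq_square mult_right_mono)
  finally have A: "2 * (exp s - exp (s/2)) \<le> 3.254 * s" using s by (simp)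
  have "3.254 * s * (1 - p) \<le> 3.254 * s * 1" using s p by (intro mult_left_mono) auto
  then have A': "3.254 * s \<le> 3.254 * s / (1 - p)" using p by (simp add: field_simps)
  \<comment> \<open>4.93 is 3.254 + 5/3 rounded up. It fits because 7 (1 - p)^2 is at least 7 *
    0.898^2, about 5.64.\<close>
  have "2 * (exp s - exp (s/2)) + (\<alpha> - 2) * (p / (1 - p)) * exp (3 * s) \<le> 4.93 * s / (1 - p)"
  proof -
    have "3.254 * s / (1 - p) + (5 / 3 * s) / (1 - p) \<le> 4.93 * s / (1 - p)"
      unfolding add_divide_distrib[symmetric] by (rule divide_right_mono) (use s p in auto)
    with A A' B show ?thesis by linarith
  qed
  also have "\<dots> \<le> 7 * s * (1 - p)"
  proof -
    have "0.898 * 0.898 \<le> (1 - p) * (1 - p)" using p_le by (intro mult_mono) auto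
    then have "4.93 \<le> 7 * ((1 - p) * (1 - p))" by simp
    from mult_left_mono[OF this, of s] s p show ?thesis by (simp add: field_simps)
  qed
  finally show ?thesis using p by (subst pos_divide_le_eq) simp_all
qed

text \<open>Both tail terms are at most b = s / ((1 + s) (1 - p)); with e < 2.72 they cost 5.44 b
  together. The factor 1 / (1 + s) in b leaves room for the term 1.51 s^2, so that s + 1.51 s^2 +
  5.44 s / (1 + s) \<le> 6.44 s.\<close>

lemma moment_budget_ge_3:
  fixes s p \<alpha> :: real
  assumes s: "0 < s" "s \<le> 1.4926" and p: "0 < p" "p < 1" and \<alpha>: "3 \<le> \<alpha>"
    and cond: "\<alpha> * p * exp (1.5 * s * (\<alpha> - 1)) \<le> s / (1 + s)"
  shows "(2 * (exp s - exp (s/2)) + exp 1 * ((\<alpha> - 2) * (p / (1 - p)) * exp (3 * s)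
            + ((\<alpha> - 2) * (p / (1 - p))) powr (\<alpha> - 2) * exp (\<alpha> * (\<alpha> - 1) * s / 2))) / (1 - p) \<le> 7 * s"
proof -
  define \<kappa> where "\<kappa> = s / (1 + s)"
  have \<kappa>: "0 < \<kappa>" "\<kappa> \<le> 0.6" using s by (auto simp: \<kappa>_def field_simps)
  have "3 * p * exp (3 * s) * (1 + s) \<le> s"
    using sampling_rate_le[of s p 2 \<alpha>] assms by simp
  moreover have "3 * p * (1 + 3 * s + 4.5 * s\<^sup>2) * (1 + s) \<le> 3 * p * exp (3 * s) * (1 + s)"
    using s p exp_lower_Taylor_quadratic[of "3 * s"]
    by (intro mult_mono) (auto simp: power_mult_distrib)
  moreover have "s \<le> 0.108 * (1 + 3 * s + 4.5 * s\<^sup>2) * (1 + s)"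
  proof -
    have "0.108 * (1 + 3 * s + 4.5 * s\<^sup>2) * (1 + s) - s
        = 0.81 * (s - 0.35)\<^sup>2 + 0.486 * s^3 + (0.008775 - 0.001 * s)"
      by (simp add: power2_eq_square power3_eq_cube field_simps)
    also have "0 \<le> \<dots>" using s by (intro add_nonneg_nonneg) auto
    finally show ?thesis by (simp only: diff_ge_0_iff_ge)
  qed
  ultimately have "(3 * p) * ((1 + 3 * s + 4.5 * s\<^sup>2) * (1 + s))
      \<le> 0.108 * ((1 + 3 * s + 4.5 * s\<^sup>2) * (1 + s))"
    unfolding mult.assoc by (meson order_trans)
  moreover have "0 < (1 + 3 * s + 4.5 * s\<^sup>2) * (1 + s)" using s by (intro mult_pos_pos add_pos_nonneg) auto
  \<comment> \<open>One third of 0.108. It is small enough because 7 * 0.964^2 exceeds 6.44.\<close>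
  ultimately have p_le: "p \<le> 0.036"
    by (subst (asm) mult_le_cancel_right_pos) auto
  define b where "b = \<kappa> / (1 - p)"
  have b: "0 < b" "b \<le> 1" using \<kappa> p p_le by (auto simp: b_def field_simps)
  have "(\<alpha> - 2) * p * exp (1.5 * s * (\<alpha> - 1)) \<le> \<alpha> * p * exp (1.5 * s * (\<alpha> - 1))"
    using s p \<alpha> by (intro mult_right_mono) auto
  with cond have r: "(\<alpha> - 2) * p * exp (1.5 * s * (\<alpha> - 1)) \<le> \<kappa>" by (simp add: \<kappa>_def)
  then have rq: "(\<alpha> - 2) * (p / (1 - p)) * exp (1.5 * s * (\<alpha> - 1)) \<le> b"
    using p by (simp add: b_def divide_right_mono)
  have "3 * s \<le> 1.5 * s * (\<alpha> - 1)" using mult_left_mono[of 2 "\<alpha> - 1" "1.5 * s"] s \<alpha> by simp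
  then have "(\<alpha> - 2) * (p / (1 - p)) * exp (3 * s) \<le> (\<alpha> - 2) * (p / (1 - p)) * exp (1.5 * s * (\<alpha> - 1))"
    using p \<alpha> by (intro mult_left_mono) auto
  with rq have A: "(\<alpha> - 2) * (p / (1 - p)) * exp (3 * s) \<le> b" by linarith
  \<comment> \<open>The exponents combine to - s (\<alpha> - 1) (\<alpha> - 3). The coefficient 1.5,
    which comes from the 6 in \<open>\<sigma>sq / (6 * G\<^sup>2)\<close>, makes this nonpositive
    from order 3 on, and b \<le> 1 allows replacing the power \<alpha> - 2 of b by 1.\<close>
  have B: "((\<alpha> - 2) * (p / (1 - p))) powr (\<alpha> - 2) * exp (\<alpha> * (\<alpha> - 1) * s / 2) \<le> b"
  proof -
    have "((\<alpha> - 2) * (p / (1 - p))) powr (\<alpha> - 2) \<le> (b * exp (- (1.5 * s * (\<alpha> - 1)))) powr (\<alpha> - 2)"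
      using rq p \<alpha> by (intro powr_mono2) (auto simp: exp_minus field_simps)
    also have "\<dots> = b powr (\<alpha> - 2) * exp (- (1.5 * s * (\<alpha> - 1)) * (\<alpha> - 2))"
      using b by (simp add: powr_mult exp_powr_real)
    finally have "((\<alpha> - 2) * (p / (1 - p))) powr (\<alpha> - 2) * exp (\<alpha> * (\<alpha> - 1) * s / 2)
        \<le> b powr (\<alpha> - 2) * exp (- (1.5 * s * (\<alpha> - 1)) * (\<alpha> - 2)) * exp (\<alpha> * (\<alpha> - 1) * s / 2)"
      by (intro mult_right_mono) auto
    also have "\<dots> = b powr (\<alpha> - 2) * exp (- (s * (\<alpha> - 1) * (\<alpha> - 3)))"
      unfolding mult.assoc by (simp flip: exp_add) (simp add: field_simps)
    also have "\<dots> \<le> b powr 1 * 1"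
      using s \<alpha> b by (intro mult_mono powr_mono') auto
    finally show ?thesis using b by simp
  qed
  have M: "2 * (exp s - exp (s/2)) \<le> s + 1.51 * s\<^sup>2" using exp_gap_le s by simp
  have "exp 1 * ((\<alpha> - 2) * (p / (1 - p)) * exp (3 * s)
            + ((\<alpha> - 2) * (p / (1 - p))) powr (\<alpha> - 2) * exp (\<alpha> * (\<alpha> - 1) * s / 2)) \<le> 2.72 * (b + b)"
    using A B p \<alpha> e_less_272 by (intro mult_mono add_mono) auto
  with M have "2 * (exp s - exp (s/2)) + exp 1 * ((\<alpha> - 2) * (p / (1 - p)) * exp (3 * s)
            + ((\<alpha> - 2) * (p / (1 - p))) powr (\<alpha> - 2) * exp (\<alpha> * (\<alpha> - 1) * s / 2))
      \<le> s + 1.51 * s\<^sup>2 + 5.44 * b" by simp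
  also have "\<dots> \<le> (s + 1.51 * s\<^sup>2) / (1 - p) + 5.44 * b"
  proof -
    have "(s + 1.51 * s\<^sup>2) * (1 - p) \<le> (s + 1.51 * s\<^sup>2) * 1" using s p by (intro mult_left_mono) auto
    then show ?thesis using p by (simp add: field_simps)
  qed
  also have "\<dots> = (s + 1.51 * s\<^sup>2 + 5.44 * \<kappa>) / (1 - p)" by (simp add: b_def add_divide_distrib)
  also have "\<dots> \<le> 6.44 * s / (1 - p)"
  proof -
    have "s * s \<le> s * 1.4926" using s by (intro mult_left_mono) auto
    moreover have "0 \<le> s * s * (2.4 - 1.51 * s)" using s by (intro mult_nonneg_nonneg) auto
    ultimately have "1.51 * s * s * (1 + s) + 5.44 * s \<le> 5.44 * s * (1 + s)"
      using s by (simp add: algebra_simps)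
    then have "s + 1.51 * s\<^sup>2 + 5.44 * \<kappa> \<le> 6.44 * s"
      using s by (simp add: \<kappa>_def field_simps power2_eq_square)
    then show ?thesis using p by (intro divide_right_mono) auto
  qed
  also have "\<dots> \<le> 7 * s * (1 - p)"
  proof -
    have "0.964 * 0.964 \<le> (1 - p) * (1 - p)" using p_le by (intro mult_mono) auto
    then have "6.44 \<le> 7 * ((1 - p) * (1 - p))" by simp
    from mult_left_mono[OF this, of s] s p show ?thesis by (simp add: field_simps)
  qed
  finally show ?thesis using p by (subst pos_divide_le_eq) simp_all
qed

subsection \<open>Isotropic Gaussian densities\<close>

definition gauss_density :: "real \<Rightarrow> 'a::euclidean_space \<Rightarrow> 'a \<Rightarrow> real" where
  "gauss_density v \<mu> x = exp (- ((x - \<mu>) \<bullet> (x - \<mu>)) / (2 * v)) / sqrt (2 * pi * v) ^ DIM('a)"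

lemma gauss_density_pos: "0 < v \<Longrightarrow> 0 < gauss_density v \<mu> x"
  by (simp add: gauss_density_def)

lemma borel_measurable_gauss_density [measurable]: "gauss_density v \<mu> \<in> borel_measurable borel"
  unfolding gauss_density_def by measurable

lemma prod_normal_density_eq:
  fixes x :: "'a::euclidean_space"
  assumes "0 < v"
  shows "(\<Prod>b\<in>Basis. normal_density 0 (sqrt v) (x \<bullet> b)) = gauss_density v 0 x"
proof -
  have "(\<Prod>b\<in>(Basis::'a set). normal_density 0 (sqrt v) (x \<bullet> b))
      = (\<Prod>b\<in>(Basis::'a set). 1 / sqrt (2 * pi * v)) * exp (\<Sum>b\<in>(Basis::'a set). - (x \<bullet> b)\<^sup>2 / (2 * v))"
    using assms by (simp add: normal_density_def prod.distrib exp_sum prod_dividef power_divide)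
  also have "(\<Sum>b\<in>(Basis::'a set). - (x \<bullet> b)\<^sup>2 / (2 * v)) = - (x \<bullet> x) / (2 * v)"
    by (subst euclidean_inner) (simp add: power2_eq_square sum_negf flip: sum_divide_distrib)
  finally show ?thesis
    by (simp add: gauss_density_def power_divide)
qed

lemma nn_integral_gauss_density_0:
  assumes "0 < v"
  shows "(\<integral>\<^sup>+x. ennreal (gauss_density v (0::'a::euclidean_space) x) \<partial>lborel) = 1"
proof -
  have "(\<integral>\<^sup>+x. ennreal (gauss_density v (0::'a) x) \<partial>lborel)
      = (\<integral>\<^sup>+x. (\<Prod>b\<in>(Basis::'a set). ennreal (normal_density 0 (sqrt v) (x \<bullet> b))) \<partial>lborel)"
    using assms by (simp add: prod_ennreal flip: prod_normal_density_eq)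
  also have "\<dots> = (\<Prod>b\<in>(Basis::'a set). \<integral>\<^sup>+x. ennreal (normal_density 0 (sqrt v) x) \<partial>lborel)"
    by (rule nn_integral_lborel_prod) auto
  also have "(\<integral>\<^sup>+x. ennreal (normal_density 0 (sqrt v) x) \<partial>lborel) = 1"
    using assms by (subst nn_integral_eq_integral) auto
  finally show ?thesis by simp
qed

lemma has_integral_gauss_density:
  fixes \<mu> :: "'a::euclidean_space"
  assumes "0 < v"
  shows "has_bochner_integral lborel (gauss_density v \<mu>) 1"
proof (rule has_bochner_integral_nn_integral)
  have "(\<integral>\<^sup>+x. ennreal (gauss_density v \<mu> x) \<partial>lborel)
      = (\<integral>\<^sup>+x. ennreal (gauss_density v \<mu> x) \<partial>distr lborel borel ((+) \<mu>))"
    by (simp add: lborel_distr_plus)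
  also have "\<dots> = (\<integral>\<^sup>+x. ennreal (gauss_density v (0::'a) x) \<partial>lborel)"
    by (subst nn_integral_distr) (auto simp: gauss_density_def)
  finally show "(\<integral>\<^sup>+x. ennreal (gauss_density v \<mu> x) \<partial>lborel) = ennreal 1"
    using assms by (simp add: nn_integral_gauss_density_0)
qed (use gauss_density_pos[OF assms, of \<mu>] in \<open>auto simp: less_imp_le\<close>)

text \<open>Translation invariance turns a shift of the argument into a shift of the centre, so
  different gradients become different densities against one and the same test function.\<close>

lemma integral_gauss_noise_shift:
  fixes c :: "'a::euclidean_space" and h :: "'a \<Rightarrow> real"
  assumes v: "0 < v" and h [measurable]: "h \<in> borel_measurable borel"
  shows "(\<integral>b. h (c + b) \<partial>gauss_noise v) = (\<integral>x. gauss_density v c x * h x \<partial>lborel)"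
proof -
  have "(\<integral>b. h (c + b) \<partial>gauss_noise v) = (\<integral>b. gauss_density v (0::'a) b * h (c + b) \<partial>lborel)"
    unfolding gauss_noise_def using gauss_density_pos[OF v, of "0::'a"]
    by (subst integral_density) (auto simp: prod_normal_density_eq[OF v] less_imp_le)
  also have "\<dots> = (\<integral>x. gauss_density v c x * h x \<partial>distr lborel borel ((+) c))"
    by (subst integral_distr) (auto simp: gauss_density_def)
  finally show ?thesis by (simp add: lborel_distr_plus)
qed

lemma sets_gauss_noise [measurable_cong]: "sets (gauss_noise v) = sets borel"
  by (simp add: gauss_noise_def)

lemma prob_space_gauss_noise:
  assumes "0 < v"
  shows "prob_space (gauss_noise v :: 'a::euclidean_space measure)"
proof
  have "emeasure (gauss_noise v :: 'a measure) (space (gauss_noise v))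
      = (\<integral>\<^sup>+x. ennreal (gauss_density v (0::'a) x) \<partial>lborel)"
    by (simp add: gauss_noise_def prod_normal_density_eq[OF assms] emeasure_density)
  then show "emeasure (gauss_noise v :: 'a measure) (space (gauss_noise v)) = 1"
    by (simp add: nn_integral_gauss_density_0[OF assms])
qed

text \<open>Completing the square: with equal variances the quotient is again a multiple of a
  Gaussian density, recentred at u + w - a. Its total mass, the exponential factor, is the cross
  term of a chi-square integral.\<close>

lemma gauss_density_mult_divide:
  fixes a :: "'a::euclidean_space"
  assumes "0 < v"
  shows "gauss_density v u x * gauss_density v w x / gauss_density v a x
    = exp ((u - a) \<bullet> (w - a) / v) * gauss_density v (u + w - a) x"
proof -
  define z d e where "z = x - a" and "d = u - a" and "e = w - a"
  have "z \<bullet> z - (z - d) \<bullet> (z - d) - (z - e) \<bullet> (z - e) = 2 * (d \<bullet> e) - (z - d - e) \<bullet> (z - d - e)"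
    by (simp add: inner_diff_left inner_diff_right inner_commute)
  then have "(z \<bullet> z - (z - d) \<bullet> (z - d) - (z - e) \<bullet> (z - e)) / (2 * v)
      = (2 * (d \<bullet> e) - (z - d - e) \<bullet> (z - d - e)) / (2 * v)"
    by (rule arg_cong)
  then have "- ((z - d) \<bullet> (z - d)) / (2 * v) + - ((z - e) \<bullet> (z - e)) / (2 * v) - - (z \<bullet> z) / (2 * v)
      = d \<bullet> e / v + - ((z - d - e) \<bullet> (z - d - e)) / (2 * v)"
    by (simp add: diff_divide_distrib)
  from arg_cong[OF this, of exp]
  have "exp (- ((z - d) \<bullet> (z - d)) / (2 * v)) * exp (- ((z - e) \<bullet> (z - e)) / (2 * v))
        / exp (- (z \<bullet> z) / (2 * v))
      = exp (d \<bullet> e / v) * exp (- ((z - d - e) \<bullet> (z - d - e)) / (2 * v))"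
    unfolding exp_add exp_diff .
  moreover have "z - d = x - u" "z - e = x - w" "z - d - e = x - (u + w - a)"
    by (simp_all add: z_def d_def e_def)
  ultimately have "exp (- ((x - u) \<bullet> (x - u)) / (2 * v)) * exp (- ((x - w) \<bullet> (x - w)) / (2 * v))
        / exp (- ((x - a) \<bullet> (x - a)) / (2 * v))
      = exp ((u - a) \<bullet> (w - a) / v) * exp (- ((x - (u + w - a)) \<bullet> (x - (u + w - a))) / (2 * v))"
    by (simp only: z_def d_def e_def)
  then have "exp (- ((x - u) \<bullet> (x - u)) / (2 * v)) * exp (- ((x - w) \<bullet> (x - w)) / (2 * v))
        / exp (- ((x - a) \<bullet> (x - a)) / (2 * v)) / C
      = exp ((u - a) \<bullet> (w - a) / v) * exp (- ((x - (u + w - a)) \<bullet> (x - (u + w - a))) / (2 * v)) / C" for C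
    by (rule arg_cong)
  moreover have "A / C * (B / C) / (D / C) = A * B / D / C" if "C \<noteq> 0" for A B C D :: real
    using that by simp
  ultimately show ?thesis
    using assms unfolding gauss_density_def times_divide_eq_right by (simp add: mult.commute)
qed

text \<open>The same completion of the square for a real exponent; the prefactor is the moment of
  order k of the likelihood ratio.\<close>

lemma gauss_density_ratio_powr:
  fixes a :: "'a::euclidean_space"
  assumes "0 < v"
  shows "(gauss_density v b x / gauss_density v a x) powr k * gauss_density v a x
    = exp (k * (k - 1) / 2 * ((b - a) \<bullet> (b - a) / v)) * gauss_density v (a + k *\<^sub>R (b - a)) x"
proof -
  define z d where "z = x - a" and "d = b - a"
  have xs: "x - b = z - d" "x - a = z" "x - (a + k *\<^sub>R d) = z - k *\<^sub>R d"
    by (simp_all add: z_def d_def)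
  have div: "exp A / C / (exp B / C) = exp (A - B)" if "C \<noteq> 0" for A B C :: real
    using that by (simp add: exp_diff)
  have "gauss_density v b x / gauss_density v a x
      = exp (- ((z - d) \<bullet> (z - d)) / (2 * v) - - (z \<bullet> z) / (2 * v))"
    unfolding gauss_density_def xs by (rule div) (use assms in simp)
  also have "- ((z - d) \<bullet> (z - d)) / (2 * v) - - (z \<bullet> z) / (2 * v) = (z \<bullet> z - (z - d) \<bullet> (z - d)) / (2 * v)"
    by (simp add: diff_divide_distrib)
  finally have r: "gauss_density v b x / gauss_density v a x = exp ((z \<bullet> z - (z - d) \<bullet> (z - d)) / (2 * v))" .
  have "k * (z \<bullet> z - (z - d) \<bullet> (z - d)) - z \<bullet> z
      = k * (k - 1) * (d \<bullet> d) - (z - k *\<^sub>R d) \<bullet> (z - k *\<^sub>R d)"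
    by (simp add: inner_diff_left inner_diff_right inner_commute) (simp add: algebra_simps)
  then have "(k * (z \<bullet> z - (z - d) \<bullet> (z - d)) - z \<bullet> z) / (2 * v)
      = (k * (k - 1) * (d \<bullet> d) - (z - k *\<^sub>R d) \<bullet> (z - k *\<^sub>R d)) / (2 * v)"
    by (rule arg_cong)
  then have "(z \<bullet> z - (z - d) \<bullet> (z - d)) / (2 * v) * k + - (z \<bullet> z) / (2 * v)
      = k * (k - 1) / 2 * (d \<bullet> d / v) + - ((z - k *\<^sub>R d) \<bullet> (z - k *\<^sub>R d)) / (2 * v)"
    by (simp add: diff_divide_distrib right_diff_distrib mult_ac)
  from arg_cong[OF this, of exp]
  have "exp ((z \<bullet> z - (z - d) \<bullet> (z - d)) / (2 * v) * k) * exp (- (z \<bullet> z) / (2 * v))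
      = exp (k * (k - 1) / 2 * (d \<bullet> d / v)) * exp (- ((z - k *\<^sub>R d) \<bullet> (z - k *\<^sub>R d)) / (2 * v))"
    unfolding exp_add .
  then show ?thesis
    unfolding r unfolding gauss_density_def d_def[symmetric] xs exp_powr_real times_divide_eq_right
    by (simp only:)
qed

subsection \<open>Moments of subsampled Gaussian mixtures\<close>

text \<open>As P / Q - 1 = p (B - B') / Q, the quadratic term is p^2 (B - B')^2 / Q, and convexity
  of the reciprocal bounds 1 / Q by the average of 1 / A and 1 / B'. The cruder Q >= (1 - p) A would
  lose a factor 1 / (1 - p), too much for orders near 1, where p need not be small.\<close>

lemma mixture_powr_le_2:
  fixes A B B' p \<alpha> :: real
  assumes pos: "0 < A" "0 < B" "0 < B'" and p: "0 < p" "p < 1" and \<alpha>: "1 \<le> \<alpha>" "\<alpha> \<le> 2"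
  defines "P \<equiv> (1 - p) * A + p * B" and "Q \<equiv> (1 - p) * A + p * B'"
  shows "(P / Q) powr \<alpha> * Q \<le> Q + \<alpha> * p * (B - B')
    + (\<alpha> - 1) * p\<^sup>2 * ((1 - p) * ((B - B')\<^sup>2 / A) + p * ((B - B')\<^sup>2 / B'))"
proof -
  have Q: "0 < Q" and P: "0 < P" using pos p by (auto simp: Q_def P_def intro!: add_pos_pos)
  have PQ: "P / Q - 1 = p * (B - B') / Q"
    using Q by (simp add: field_simps P_def Q_def)
  have "(P / Q) powr \<alpha> * Q \<le> (1 + \<alpha> * (P / Q - 1) + (\<alpha> - 1) * (P / Q - 1)\<^sup>2) * Q"
    using P Q \<alpha> by (intro mult_right_mono powr_le_quadratic) auto
  also have "\<dots> = Q + \<alpha> * p * (B - B') + (\<alpha> - 1) * p\<^sup>2 * ((B - B')\<^sup>2 * (1 / Q))"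
    unfolding PQ using Q by (simp add: power2_eq_square distrib_right divide_inverse) (simp add: field_simps)
  also have "\<dots> \<le> Q + \<alpha> * p * (B - B')
      + (\<alpha> - 1) * p\<^sup>2 * ((B - B')\<^sup>2 * ((1 - p) / A + p / B'))"
  proof (intro add_left_mono mult_left_mono)
    have "2 * (A * B') \<le> A * A + B' * B'"
      using zero_le_square[of "A - B'"] by (simp add: algebra_simps)
    then have "2 \<le> A / B' + B' / A" using pos by (simp add: field_simps)
    then have "(1 - p) * p * 2 \<le> (1 - p) * p * (A / B' + B' / A)"
      using p by (intro mult_left_mono) auto
    moreover have "Q * ((1 - p) / A + p / B') = (1 - p) * (1 - p) + p * p + (1 - p) * p * (A / B' + B' / A)"
      using pos by (simp add: Q_def distrib_left distrib_right) (simp add: field_simps)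
    ultimately have "1 \<le> Q * ((1 - p) / A + p / B')" by (simp add: algebra_simps)
    then show "1 / Q \<le> (1 - p) / A + p / B'" using Q by (simp add: pos_divide_le_eq mult.commute)
  qed (use \<alpha> in auto)
  also have "(B - B')\<^sup>2 * ((1 - p) / A + p / B') = (1 - p) * ((B - B')\<^sup>2 / A) + p * ((B - B')\<^sup>2 / B')"
    by (simp add: distrib_left mult.commute)
  finally show ?thesis .
qed

text \<open>The power of the ratio matters only if B > B'. There P / Q is bounded in terms of B / A
  alone and (B - B')^2 \<le> B^2, so the extra term carrying h is free of B'. The bound h stays
  abstract because its choice depends on whether \<alpha> exceeds 3.\<close>

lemma mixture_powr_gt_2:
  fixes A B B' p \<alpha> h :: real
  assumes pos: "0 < A" "0 < B" "0 < B'" and p: "0 < p" "p < 1" and \<alpha>: "2 \<le> \<alpha>"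
    and h: "0 \<le> h" "(1 + p / (1 - p) * (B / A)) powr (\<alpha> - 2) \<le> 1 + h"
  defines "P \<equiv> (1 - p) * A + p * B" and "Q \<equiv> (1 - p) * A + p * B'"
  shows "(P / Q) powr \<alpha> * Q \<le> Q + \<alpha> * p * (B - B')
    + \<alpha> * (\<alpha> - 1) / 2 * p\<^sup>2 * (((B - B')\<^sup>2 / A + h * ((B / A)\<^sup>2 * A)) / (1 - p))"
proof -
  have Q: "0 < Q" and P: "0 < P" using pos p by (auto simp: Q_def P_def intro!: add_pos_pos)
  have QA: "(1 - p) * A \<le> Q" "0 < (1 - p) * A" using pos p by (auto simp: Q_def)
  have PQ: "P / Q - 1 = p * (B - B') / Q"
    using Q by (simp add: field_simps P_def Q_def)
  have key: "(B - B')\<^sup>2 / Q * max 1 (P / Q) powr (\<alpha> - 2) \<le> ((B - B')\<^sup>2 + h * B\<^sup>2) / ((1 - p) * A)"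
  proof (cases "B \<le> B'")
    case True
    then have "P / Q \<le> 1" using Q p by (simp add: P_def Q_def)
    then have "(B - B')\<^sup>2 / Q * max 1 (P / Q) powr (\<alpha> - 2) = (B - B')\<^sup>2 / Q" by (simp add: max_def)
    also have "\<dots> \<le> ((B - B')\<^sup>2 + h * B\<^sup>2) / ((1 - p) * A)"
      using QA h by (intro frac_le) auto
    finally show ?thesis .
  next
    case False
    then have "p * (B - B') / Q \<le> p * B / ((1 - p) * A)"
      using QA pos p by (intro frac_le mult_left_mono) auto
    then have "P / Q \<le> 1 + p / (1 - p) * (B / A)" using PQ by simp
    then have "max 1 (P / Q) \<le> 1 + p / (1 - p) * (B / A)" using pos p by simp
    then have "max 1 (P / Q) powr (\<alpha> - 2) \<le> (1 + p / (1 - p) * (B / A)) powr (\<alpha> - 2)"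
      using \<alpha> by (intro powr_mono2) auto
    with h have "max 1 (P / Q) powr (\<alpha> - 2) \<le> 1 + h" by linarith
    then have "(B - B')\<^sup>2 / Q * max 1 (P / Q) powr (\<alpha> - 2) \<le> (B - B')\<^sup>2 / ((1 - p) * A) * (1 + h)"
      using QA by (intro mult_mono frac_le) auto
    also have "\<dots> = ((B - B')\<^sup>2 + h * (B - B')\<^sup>2) / ((1 - p) * A)" by (simp add: algebra_simps)
    also have "\<dots> \<le> ((B - B')\<^sup>2 + h * B\<^sup>2) / ((1 - p) * A)"
      using QA h False pos
      by (intro divide_right_mono add_left_mono mult_left_mono power_mono) auto
    finally show ?thesis .
  qed
  have "(P / Q) powr \<alpha> * Q
      \<le> (1 + \<alpha> * (P / Q - 1) + \<alpha> * (\<alpha> - 1) / 2 * (P / Q - 1)\<^sup>2 * max 1 (P / Q) powr (\<alpha> - 2)) * Q"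
    using P Q \<alpha> by (intro mult_right_mono powr_le_Taylor) auto
  also have "\<dots> = Q + \<alpha> * p * (B - B')
      + \<alpha> * (\<alpha> - 1) / 2 * p\<^sup>2 * ((B - B')\<^sup>2 / Q * max 1 (P / Q) powr (\<alpha> - 2))"
    unfolding PQ using Q by (simp add: power2_eq_square distrib_right)
  also have "\<dots> \<le> Q + \<alpha> * p * (B - B')
      + \<alpha> * (\<alpha> - 1) / 2 * p\<^sup>2 * (((B - B')\<^sup>2 + h * B\<^sup>2) / ((1 - p) * A))"
    using key \<alpha> by (intro add_left_mono mult_left_mono) auto
  also have "((B - B')\<^sup>2 + h * B\<^sup>2) / ((1 - p) * A) = ((B - B')\<^sup>2 / A + h * ((B / A)\<^sup>2 * A)) / (1 - p)"
    using pos by (simp add: add_divide_distrib power2_eq_square mult.commute)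
  finally show ?thesis .
qed

lemma integral_le_of_has_bochner_integral:
  fixes f g :: "'a \<Rightarrow> real"
  assumes g: "has_bochner_integral M g I" and f: "f \<in> borel_measurable M"
    and "\<And>x. 0 \<le> f x" "\<And>x. f x \<le> g x"
  shows "integrable M f" "(\<integral>x. f x \<partial>M) \<le> I"
proof -
  have ig: "integrable M g" "(\<integral>x. g x \<partial>M) = I" using g by (auto simp: has_bochner_integral_iff)
  show "integrable M f"
    by (rule Bochner_Integration.integrable_bound[OF ig(1) f])
      (use assms in \<open>auto intro: order_trans[OF _ abs_ge_self]\<close>)
  then show "(\<integral>x. f x \<partial>M) \<le> I"
    using assms ig integral_mono[of M f g] by auto
qed

section \<open>Gaussian integrals and the moment of the mixture ratio\<close>

definition gauss_mix :: "real \<Rightarrow> real \<Rightarrow> 'a::euclidean_space \<Rightarrow> 'a \<Rightarrow> 'a \<Rightarrow> real" where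
  "gauss_mix v p a b x = (1 - p) * gauss_density v a x + p * gauss_density v b x"

lemma borel_measurable_gauss_mix [measurable]: "gauss_mix v p a b \<in> borel_measurable borel"
  unfolding gauss_mix_def by measurable

lemma gauss_mix_pos: "0 < v \<Longrightarrow> 0 < p \<Longrightarrow> p < 1 \<Longrightarrow> 0 < gauss_mix v p a b x"
  using gauss_density_pos[of v a x] gauss_density_pos[of v b x]
  by (simp add: gauss_mix_def add_pos_pos)

context
  fixes a b b' :: "'a::euclidean_space" and v s :: real
  assumes v: "0 < v"
    and close: "(b - a) \<bullet> (b - a) \<le> s * v" "(b' - a) \<bullet> (b' - a) \<le> s * v" "(b - b') \<bullet> (b - b') \<le> s * v"
begin

lemma has_integral_gauss_cross:
  "has_bochner_integral lborel (\<lambda>x. gauss_density v u x * gauss_density v w x / gauss_density v c x)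
    (exp ((u - c) \<bullet> (w - c) / v))"
  unfolding gauss_density_mult_divide[OF v]
  using has_bochner_integral_mult_right[OF has_integral_gauss_density[OF v], of "exp ((u - c) \<bullet> (w - c) / v)"]
  by simp

text \<open>Expanding the square gives three cross integrals. Polarisation expresses the mixed inner
  product through the three squared distances, which is the form of
  \<open>exp_two_point_le\<close>.\<close>

lemma gauss_chi_square_common:
  obtains I where
    "has_bochner_integral lborel
      (\<lambda>x. (gauss_density v b x - gauss_density v b' x)\<^sup>2 / gauss_density v a x) I"
    "I \<le> 2 * (exp s - exp (s/2))"
proof
  let ?I = "exp ((b - a) \<bullet> (b - a) / v) + exp ((b' - a) \<bullet> (b' - a) / v) - 2 * exp ((b - a) \<bullet> (b' - a) / v)"
  have "has_bochner_integral lborel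
      (\<lambda>x. gauss_density v b x * gauss_density v b x / gauss_density v a x
          + gauss_density v b' x * gauss_density v b' x / gauss_density v a x
          - 2 * (gauss_density v b x * gauss_density v b' x / gauss_density v a x)) ?I"
    by (intro has_bochner_integral_add has_bochner_integral_diff has_bochner_integral_mult_right
        has_integral_gauss_cross)
  moreover have "(B - B')\<^sup>2 / A = B * B / A + B' * B' / A - 2 * (B * B' / A)" for A B B' :: real
    by (simp add: power2_eq_square algebra_simps add_divide_distrib diff_divide_distrib)
  ultimately show "has_bochner_integral lborel
      (\<lambda>x. (gauss_density v b x - gauss_density v b' x)\<^sup>2 / gauss_density v a x) ?I"
    by simp
  let ?X = "(b - a) \<bullet> (b - a) / v" and ?Y = "(b' - a) \<bullet> (b' - a) / v" and ?Z = "(b - b') \<bullet> (b - b') / v"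
  have "2 * ((b - a) \<bullet> (b' - a)) = (b - a) \<bullet> (b - a) + (b' - a) \<bullet> (b' - a) - (b - b') \<bullet> (b - b')"
    by (simp add: inner_diff_left inner_diff_right inner_commute)
  then have "(b - a) \<bullet> (b' - a) = ((b - a) \<bullet> (b - a) + (b' - a) \<bullet> (b' - a) - (b - b') \<bullet> (b - b')) / 2"
    by (metis nonzero_mult_div_cancel_left zero_neq_numeral)
  then have cross: "(b - a) \<bullet> (b' - a) / v = (?X + ?Y - ?Z) / 2"
    by (simp add: add_divide_distrib diff_divide_distrib)
  show "?I \<le> 2 * (exp s - exp (s/2))"
    unfolding cross using exp_two_point_le[of ?X s ?Y ?Z] close v by (simp add: pos_divide_le_eq)
qed

text \<open>The integral is exp (|b - b'|^2 / v) - 1; the inequality (exp (s/2) - 1)^2 >= 0 weakens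
  exp s - 1 to the bound shared with the integral over A.\<close>

lemma gauss_chi_square_le:
  obtains I where
    "has_bochner_integral lborel
      (\<lambda>x. (gauss_density v b x - gauss_density v b' x)\<^sup>2 / gauss_density v b' x) I"
    "I \<le> 2 * (exp s - exp (s/2))"
proof
  let ?I = "exp ((b - b') \<bullet> (b - b') / v) - 2 * 1 + 1"
  have "has_bochner_integral lborel
      (\<lambda>x. gauss_density v b x * gauss_density v b x / gauss_density v b' x
          - 2 * gauss_density v b x + gauss_density v b' x) ?I"
    by (intro has_bochner_integral_add has_bochner_integral_diff has_bochner_integral_mult_right
        has_integral_gauss_cross has_integral_gauss_density v)
  moreover have "(B - B')\<^sup>2 / B' = B * B / B' - 2 * B + B'" if "0 < B'" for B B' :: real
    using that by (simp add: power2_eq_square field_simps)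
  ultimately show "has_bochner_integral lborel
      (\<lambda>x. (gauss_density v b x - gauss_density v b' x)\<^sup>2 / gauss_density v b' x) ?I"
    using gauss_density_pos[OF v, of b'] by simp
  have "exp ((b - b') \<bullet> (b - b') / v) \<le> exp s" using close v by (simp add: pos_divide_le_eq)
  moreover have "0 \<le> (exp (s/2) - 1) * (exp (s/2) - 1)" by simp
  moreover have "exp (s/2) * exp (s/2) = exp s" by (simp flip: exp_add)
  ultimately have "2 * exp (s/2) \<le> 1 + exp s" "exp ((b - b') \<bullet> (b - b') / v) \<le> exp s"
    by (simp_all only: left_diff_distrib right_diff_distrib)
  then show "?I \<le> 2 * (exp s - exp (s/2))" by argo
qed

lemma has_integral_gauss_ratio_powr:
  assumes "1 \<le> k"
  obtains I where
    "has_bochner_integral lborel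
      (\<lambda>x. (gauss_density v b x / gauss_density v a x) powr k * gauss_density v a x) I"
    "I \<le> exp (k * (k - 1) * s / 2)"
proof
  show "has_bochner_integral lborel
      (\<lambda>x. (gauss_density v b x / gauss_density v a x) powr k * gauss_density v a x)
      (exp (k * (k - 1) / 2 * ((b - a) \<bullet> (b - a) / v)))"
    unfolding gauss_density_ratio_powr[OF v]
    using has_bochner_integral_mult_right[OF has_integral_gauss_density[OF v],
        of "exp (k * (k - 1) / 2 * ((b - a) \<bullet> (b - a) / v))"]
    by simp
  show "exp (k * (k - 1) / 2 * ((b - a) \<bullet> (b - a) / v)) \<le> exp (k * (k - 1) * s / 2)"
  proof -
    have "(b - a) \<bullet> (b - a) / v \<le> s" using close v by (simp add: pos_divide_le_eq)
    then have "k * (k - 1) / 2 * ((b - a) \<bullet> (b - a) / v) \<le> k * (k - 1) / 2 * s"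
      using assms by (intro mult_left_mono) auto
    then show ?thesis by simp
  qed
qed

context
  fixes p \<alpha> :: real
  assumes s: "0 < s" "s \<le> 1.4926" and p: "0 < p" "p < 1" and \<alpha>: "1 < \<alpha>"
    and cond: "\<alpha> * p * exp (1.5 * s * (\<alpha> - 1)) \<le> s / (1 + s)"
begin

text \<open>The first-order term vanishes because B and B' have the same mass. This is why a step
  costs order p^2 and not p.\<close>

lemma has_integral_mixture_linear:
  "has_bochner_integral lborel
    (\<lambda>x. gauss_mix v p a b' x + \<alpha> * p * (gauss_density v b x - gauss_density v b' x)) 1"
proof -
  have "has_bochner_integral lborel
    (\<lambda>x. gauss_mix v p a b' x + \<alpha> * p * (gauss_density v b x - gauss_density v b' x))
    (((1 - p) * 1 + p * 1) + \<alpha> * p * (1 - 1))"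
    unfolding gauss_mix_def
    by (intro has_bochner_integral_add has_bochner_integral_diff has_bochner_integral_mult_right
        has_integral_gauss_density v)
  then show ?thesis by simp
qed

lemma moment_le_of_remainder:
  assumes R: "has_bochner_integral lborel R I" and I: "I \<le> 7 * s"
    and le: "\<And>x. (gauss_mix v p a b x / gauss_mix v p a b' x) powr \<alpha> * gauss_mix v p a b' x
      \<le> gauss_mix v p a b' x + \<alpha> * p * (gauss_density v b x - gauss_density v b' x) + \<alpha> * (\<alpha> - 1) / 2 * p\<^sup>2 * R x"
  shows "integrable lborel (\<lambda>x. (gauss_mix v p a b x / gauss_mix v p a b' x) powr \<alpha> * gauss_mix v p a b' x)"
    and "(\<integral>x. (gauss_mix v p a b x / gauss_mix v p a b' x) powr \<alpha> * gauss_mix v p a b' x \<partial>lborel) \<le> exp (3.5 * p\<^sup>2 * \<alpha> * (\<alpha> - 1) * s)"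
proof -
  have g: "has_bochner_integral lborel
     (\<lambda>x. gauss_mix v p a b' x + \<alpha> * p * (gauss_density v b x - gauss_density v b' x) + \<alpha> * (\<alpha> - 1) / 2 * p\<^sup>2 * R x)
     (1 + \<alpha> * (\<alpha> - 1) / 2 * p\<^sup>2 * I)"
    by (intro has_bochner_integral_add has_integral_mixture_linear has_bochner_integral_mult_right R)
  have nn: "0 \<le> (gauss_mix v p a b x / gauss_mix v p a b' x) powr \<alpha> * gauss_mix v p a b' x" for x
    using gauss_mix_pos[OF v p, of a b' x] by simp
  have m: "(\<lambda>x. (gauss_mix v p a b x / gauss_mix v p a b' x) powr \<alpha> * gauss_mix v p a b' x) \<in> borel_measurable lborel" by measurable
  show "integrable lborel (\<lambda>x. (gauss_mix v p a b x / gauss_mix v p a b' x) powr \<alpha> * gauss_mix v p a b' x)"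
    by (rule integral_le_of_has_bochner_integral(1)[OF g m nn le])
  have "(\<integral>x. (gauss_mix v p a b x / gauss_mix v p a b' x) powr \<alpha> * gauss_mix v p a b' x \<partial>lborel) \<le> 1 + \<alpha> * (\<alpha> - 1) / 2 * p\<^sup>2 * I"
    by (rule integral_le_of_has_bochner_integral(2)[OF g m nn le])
  also have "\<dots> \<le> 1 + \<alpha> * (\<alpha> - 1) / 2 * p\<^sup>2 * (7 * s)"
    using I \<alpha> by (intro add_left_mono mult_left_mono) auto
  also have "\<dots> = 1 + 3.5 * p\<^sup>2 * \<alpha> * (\<alpha> - 1) * s" by simp
  also have "\<dots> \<le> exp (3.5 * p\<^sup>2 * \<alpha> * (\<alpha> - 1) * s)" by (rule exp_ge_add_one_self)
  finally show "(\<integral>x. (gauss_mix v p a b x / gauss_mix v p a b' x) powr \<alpha> * gauss_mix v p a b' x \<partial>lborel) \<le> exp (3.5 * p\<^sup>2 * \<alpha> * (\<alpha> - 1) * s)" .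
qed

lemma mixture_remainder:
  obtains R I where "has_bochner_integral lborel R I" "I \<le> 7 * s"
    "\<And>x. (gauss_mix v p a b x / gauss_mix v p a b' x) powr \<alpha> * gauss_mix v p a b' x
      \<le> gauss_mix v p a b' x + \<alpha> * p * (gauss_density v b x - gauss_density v b' x) + \<alpha> * (\<alpha> - 1) / 2 * p\<^sup>2 * R x"
proof -
  have pos: "0 < gauss_density v \<mu> x" for \<mu> x :: 'a by (rule gauss_density_pos[OF v])
  let ?A = "gauss_density v a" and ?B = "gauss_density v b" and ?B' = "gauss_density v b'"
  obtain I1 where I1: "has_bochner_integral lborel (\<lambda>x. (?B x - ?B' x)\<^sup>2 / ?A x) I1"
    "I1 \<le> 2 * (exp s - exp (s/2))" by (rule gauss_chi_square_common)
  define q where "q = p / (1 - p)"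
  have q: "0 < q" using p by (simp add: q_def)
  \<comment> \<open>The exponent \<alpha> - 2 of the ratio factor decides: negative or zero, at most
    1 and hence below its tangent at 1, or above 1, where \<open>one_plus_powr_le\<close> takes
    over.\<close>
  consider "\<alpha> \<le> 2" | "2 < \<alpha>" "\<alpha> \<le> 3" | "3 < \<alpha>" by linarith
  then show ?thesis
  proof cases
    case 1
    obtain I2 where I2: "has_bochner_integral lborel (\<lambda>x. (?B x - ?B' x)\<^sup>2 / ?B' x) I2"
      "I2 \<le> 2 * (exp s - exp (s/2))" by (rule gauss_chi_square_le)
    \<comment> \<open>The factor 2 / \<alpha> turns the coefficient \<alpha> - 1 of the quadratic
      bound into the common \<alpha> (\<alpha> - 1) / 2.\<close>
    let ?R = "\<lambda>x. 2 / \<alpha> * ((1 - p) * ((?B x - ?B' x)\<^sup>2 / ?A x) + p * ((?B x - ?B' x)\<^sup>2 / ?B' x))"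
    show ?thesis
    proof (rule that)
      show "has_bochner_integral lborel ?R (2 / \<alpha> * ((1 - p) * I1 + p * I2))"
        by (intro has_bochner_integral_add has_bochner_integral_mult_right I1 I2)
      have "2 * (exp s - exp (s/2)) \<le> s + 1.51 * s\<^sup>2" using exp_gap_le s by simp
      also have "s\<^sup>2 \<le> 1.4926 * s" using s by (simp add: power2_eq_square mult_right_mono)
      finally have M: "2 * (exp s - exp (s/2)) \<le> 3.5 * s" using s by simp
      have "(1 - p) * I1 + p * I2 \<le> (1 - p) * (3.5 * s) + p * (3.5 * s)"
        using I1 I2 M p by (intro add_mono mult_left_mono) auto
      also have "\<dots> = 3.5 * s" by (simp add: field_simps)
      finally have "2 / \<alpha> * ((1 - p) * I1 + p * I2) \<le> 2 / \<alpha> * (3.5 * s)"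
        using \<alpha> by (intro mult_left_mono) auto
      also have "\<dots> \<le> 2 * (3.5 * s)" using s \<alpha> by (intro mult_right_mono) (auto simp: field_simps)
      finally show "2 / \<alpha> * ((1 - p) * I1 + p * I2) \<le> 7 * s" by simp
      show "(gauss_mix v p a b x / gauss_mix v p a b' x) powr \<alpha> * gauss_mix v p a b' x
        \<le> gauss_mix v p a b' x + \<alpha> * p * (?B x - ?B' x) + \<alpha> * (\<alpha> - 1) / 2 * p\<^sup>2 * ?R x" for x
      proof -
        have e: "\<alpha> * (\<alpha> - 1) / 2 * p\<^sup>2 * (2 / \<alpha> * y) = (\<alpha> - 1) * p\<^sup>2 * y" for y using \<alpha> by simp
        show ?thesis unfolding e gauss_mix_def
          using pos p \<alpha> 1 by (intro mixture_powr_le_2) auto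
      qed
    qed
  next
    case 2
    obtain I3 where I3: "has_bochner_integral lborel (\<lambda>x. (?B x / ?A x) powr 3 * ?A x) I3"
      "I3 \<le> exp (3 * (3 - 1) * s / 2)" by (rule has_integral_gauss_ratio_powr[of 3]) simp
    let ?R = "\<lambda>x. ((?B x - ?B' x)\<^sup>2 / ?A x + (\<alpha> - 2) * q * ((?B x / ?A x) powr 3 * ?A x)) / (1 - p)"
    show ?thesis
    proof (rule that)
      show "has_bochner_integral lborel ?R ((I1 + (\<alpha> - 2) * q * I3) / (1 - p))"
        by (intro has_bochner_integral_add has_bochner_integral_mult_right has_bochner_integral_divide I1 I3)
      have "(I1 + (\<alpha> - 2) * q * I3) / (1 - p)
          \<le> (2 * (exp s - exp (s/2)) + (\<alpha> - 2) * q * exp (3 * s)) / (1 - p)"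
        using p q 2 I1 I3 by (intro divide_right_mono add_mono mult_left_mono) auto
      also have "\<dots> \<le> 7 * s" unfolding q_def using moment_budget_le_3[OF s p] 2 cond by simp
      finally show "(I1 + (\<alpha> - 2) * q * I3) / (1 - p) \<le> 7 * s" .
      fix x
      define L where "L = ?B x / ?A x"
      have L: "0 < L" using pos by (simp add: L_def)
      have "(1 + q * L) powr (\<alpha> - 2) \<le> 1 + (\<alpha> - 2) * q * L"
        using powr_le_affine[of "1 + q * L" "\<alpha> - 2"] 2 q L by (simp add: mult.assoc add_pos_pos)
      moreover have "0 \<le> (\<alpha> - 2) * q * L" using 2 q L by simp
      ultimately have "(gauss_mix v p a b x / gauss_mix v p a b' x) powr \<alpha> * gauss_mix v p a b' x \<le> gauss_mix v p a b' x + \<alpha> * p * (?B x - ?B' x)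
          + \<alpha> * (\<alpha> - 1) / 2 * p\<^sup>2 * (((?B x - ?B' x)\<^sup>2 / ?A x + (\<alpha> - 2) * q * L * (L\<^sup>2 * ?A x)) / (1 - p))"
        unfolding L_def q_def gauss_mix_def using pos p 2 by (intro mixture_powr_gt_2) auto
      moreover have "(\<alpha> - 2) * q * L * (L\<^sup>2 * ?A x) = (\<alpha> - 2) * q * (L powr 3 * ?A x)"
        using L by (simp add: power2_eq_square power3_eq_cube)
      ultimately show "(gauss_mix v p a b x / gauss_mix v p a b' x) powr \<alpha> * gauss_mix v p a b' x
        \<le> gauss_mix v p a b' x + \<alpha> * p * (?B x - ?B' x) + \<alpha> * (\<alpha> - 1) / 2 * p\<^sup>2 * ?R x"
        by (simp add: L_def)
    qed
  next
    case 3
    obtain I3 where I3: "has_bochner_integral lborel (\<lambda>x. (?B x / ?A x) powr 3 * ?A x) I3"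
      "I3 \<le> exp (3 * (3 - 1) * s / 2)" by (rule has_integral_gauss_ratio_powr[of 3]) simp
    obtain I4 where I4: "has_bochner_integral lborel (\<lambda>x. (?B x / ?A x) powr \<alpha> * ?A x) I4"
      "I4 \<le> exp (\<alpha> * (\<alpha> - 1) * s / 2)" by (rule has_integral_gauss_ratio_powr[of \<alpha>]) (use \<alpha> in simp)
    let ?c = "(\<alpha> - 2) * q"
    let ?R = "\<lambda>x. ((?B x - ?B' x)\<^sup>2 / ?A x + exp 1 * (?c * ((?B x / ?A x) powr 3 * ?A x)
      + ?c powr (\<alpha> - 2) * ((?B x / ?A x) powr \<alpha> * ?A x))) / (1 - p)"
    show ?thesis
    proof (rule that)
      show "has_bochner_integral lborel ?R ((I1 + exp 1 * (?c * I3 + ?c powr (\<alpha> - 2) * I4)) / (1 - p))"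
        by (intro has_bochner_integral_add has_bochner_integral_mult_right has_bochner_integral_divide I1 I3 I4)
      have "(I1 + exp 1 * (?c * I3 + ?c powr (\<alpha> - 2) * I4)) / (1 - p)
          \<le> (2 * (exp s - exp (s/2)) + exp 1 * (?c * exp (3 * s)
              + ?c powr (\<alpha> - 2) * exp (\<alpha> * (\<alpha> - 1) * s / 2))) / (1 - p)"
        using p q 3 I1 I3 I4 by (intro divide_right_mono add_mono mult_left_mono) auto
      also have "\<dots> \<le> 7 * s" unfolding q_def using moment_budget_ge_3[OF s p] 3 cond by simp
      finally show "(I1 + exp 1 * (?c * I3 + ?c powr (\<alpha> - 2) * I4)) / (1 - p) \<le> 7 * s" .
      fix x
      define L where "L = ?B x / ?A x"
      have L: "0 < L" using pos by (simp add: L_def)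
      let ?h = "exp 1 * (?c * L + (?c * L) powr (\<alpha> - 2))"
      have "(1 + q * L) powr (\<alpha> - 2) \<le> 1 + ?h"
        using one_plus_powr_le[of "q * L" "\<alpha> - 2"] 3 q L by (simp add: mult.assoc)
      moreover have "0 \<le> ?h" using 3 q L by simp
      ultimately have main: "(gauss_mix v p a b x / gauss_mix v p a b' x) powr \<alpha> * gauss_mix v p a b' x \<le> gauss_mix v p a b' x + \<alpha> * p * (?B x - ?B' x)
          + \<alpha> * (\<alpha> - 1) / 2 * p\<^sup>2 * (((?B x - ?B' x)\<^sup>2 / ?A x + ?h * (L\<^sup>2 * ?A x)) / (1 - p))"
        unfolding L_def q_def gauss_mix_def using pos p 3 by (intro mixture_powr_gt_2) auto
      have eq: "?h * (L\<^sup>2 * ?A x) = exp 1 * (?c * (L powr 3 * ?A x) + ?c powr (\<alpha> - 2) * (L powr \<alpha> * ?A x))"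
      proof -
        have "L powr \<alpha> = L powr (\<alpha> - 2) * L\<^sup>2" using L powr_add[of L "\<alpha> - 2" 2] by simp
        moreover have "L powr 3 = L * L\<^sup>2" using L by (simp add: power2_eq_square power3_eq_cube)
        moreover have "(?c * L) powr (\<alpha> - 2) = ?c powr (\<alpha> - 2) * L powr (\<alpha> - 2)"
          using 3 q L by (intro powr_mult) 
        ultimately show ?thesis by (simp only: distrib_left distrib_right mult_ac)
      qed
      show "(gauss_mix v p a b x / gauss_mix v p a b' x) powr \<alpha> * gauss_mix v p a b' x
        \<le> gauss_mix v p a b' x + \<alpha> * p * (?B x - ?B' x) + \<alpha> * (\<alpha> - 1) / 2 * p\<^sup>2 * ?R x"
        using main unfolding eq unfolding L_def .
    qed
  qed
qed

lemma gauss_mix_moment: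
  "integrable lborel (\<lambda>x. (gauss_mix v p a b x / gauss_mix v p a b' x) powr \<alpha> * gauss_mix v p a b' x)
    \<and> (\<integral>x. (gauss_mix v p a b x / gauss_mix v p a b' x) powr \<alpha> * gauss_mix v p a b' x \<partial>lborel)
        \<le> exp (3.5 * p\<^sup>2 * \<alpha> * (\<alpha> - 1) * s)"
  by (rule mixture_remainder) (intro conjI moment_le_of_remainder; assumption)

end

end

subsection \<open>Hoelder domination\<close>

lemma Holder_integral:
  fixes u w :: "'a \<Rightarrow> real"
  assumes \<alpha>: "1 < \<alpha>" "1 < \<beta>" "1 / \<alpha> + 1 / \<beta> = 1"
    and m [measurable]: "u \<in> borel_measurable M" "w \<in> borel_measurable M"
    and nn: "\<And>x. 0 \<le> u x" "\<And>x. 0 \<le> w x"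
    and i: "integrable M (\<lambda>x. u x powr \<alpha>)" "integrable M (\<lambda>x. w x powr \<beta>)"
  shows "(\<integral>x. u x * w x \<partial>M) \<le> (\<integral>x. u x powr \<alpha> \<partial>M) powr (1 / \<alpha>) * (\<integral>x. w x powr \<beta> \<partial>M) powr (1 / \<beta>)"
proof -
  define U W where "U = (\<integral>x. u x powr \<alpha> \<partial>M)" and "W = (\<integral>x. w x powr \<beta> \<partial>M)"
  have UW: "0 \<le> U" "0 \<le> W" by (simp_all add: U_def W_def)
  have zero: "(\<integral>x. u x * w x \<partial>M) = 0" if "U = 0 \<or> W = 0"
  proof -
    have "(AE x in M. u x powr \<alpha> = 0) \<or> (AE x in M. w x powr \<beta> = 0)"
      using that i unfolding U_def W_def by (simp add: integral_nonneg_eq_0_iff_AE)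
    then have "AE x in M. u x * w x = 0" by auto
    then show ?thesis by (simp add: integral_eq_zero_AE)
  qed
  show ?thesis
  proof (cases "U = 0 \<or> W = 0")
    case True
    then show ?thesis using zero by simp
  next
    case False
    define g where "g x = U powr (1/\<alpha>) * W powr (1/\<beta>) * (u x powr \<alpha> / (\<alpha> * U) + w x powr \<beta> / (\<beta> * W))" for x
    have U: "0 < U" "0 < W" using UW False by auto
    have le: "u x * w x \<le> g x" for x
    proof -
      have "u x / U powr (1/\<alpha>) * (w x / W powr (1/\<beta>))
          \<le> (u x / U powr (1/\<alpha>)) powr \<alpha> / \<alpha> + (w x / W powr (1/\<beta>)) powr \<beta> / \<beta>"
        using \<alpha> nn by (intro Youngs_inequality) auto
      also have "\<dots> = u x powr \<alpha> / (\<alpha> * U) + w x powr \<beta> / (\<beta> * W)"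
        using U nn \<alpha> by (simp add: powr_divide powr_powr mult.commute)
      finally have "U powr (1/\<alpha>) * W powr (1/\<beta>) * (u x / U powr (1/\<alpha>) * (w x / W powr (1/\<beta>))) \<le> g x"
        unfolding g_def by (intro mult_left_mono) auto
      then show ?thesis using U by simp
    qed
    have ig: "integrable M g" unfolding g_def using i by simp
    have iuw: "integrable M (\<lambda>x. u x * w x)"
      by (rule Bochner_Integration.integrable_bound[OF ig])
        (use nn in \<open>auto simp: abs_mult intro: order_trans[OF le abs_ge_self]\<close>)
    have "(\<integral>x. u x * w x \<partial>M) \<le> (\<integral>x. g x \<partial>M)"
      by (rule integral_mono[OF iuw ig le])
    also have "\<dots> = U powr (1/\<alpha>) * W powr (1/\<beta>) * (U / (\<alpha> * U) + W / (\<beta> * W))"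
      unfolding g_def using i by (simp add: U_def W_def)
    also have "\<dots> = U powr (1/\<alpha>) * W powr (1/\<beta>)" using U \<alpha> by simp
    finally show ?thesis by (simp add: U_def W_def)
  qed
qed

lemma powr_le_one:
  fixes x a :: real
  shows "0 \<le> x \<Longrightarrow> x \<le> 1 \<Longrightarrow> 0 \<le> a \<Longrightarrow> x powr a \<le> 1"
  using powr_mono2[of a x 1] by simp

text \<open>Test functions with values in [0, 1] are integrable for every finite measure, and the
  class is closed under powers and under averaging along a probability kernel, as composition
  requires.\<close>

definition Holder_dominated :: "real \<Rightarrow> real \<Rightarrow> 'b measure \<Rightarrow> 'b measure \<Rightarrow> bool" where
  "Holder_dominated \<beta> c P Q \<longleftrightarrow> (\<forall>f \<in> borel_measurable P. (\<forall>x. 0 \<le> f x \<and> f x \<le> 1) \<longrightarrow>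
     (\<integral>x. f x \<partial>P) \<le> c * (\<integral>x. f x powr \<beta> \<partial>Q) powr (1 / \<beta>))"

lemma Holder_dominatedD:
  "Holder_dominated \<beta> c P Q \<Longrightarrow> f \<in> borel_measurable P \<Longrightarrow> (\<And>x. 0 \<le> f x) \<Longrightarrow> (\<And>x. f x \<le> 1) \<Longrightarrow>
    (\<integral>x. f x \<partial>P) \<le> c * (\<integral>x. f x powr \<beta> \<partial>Q) powr (1 / \<beta>)"
  unfolding Holder_dominated_def by blast

lemma Holder_dominated_return:
  assumes "0 < \<beta>" "x \<in> space M"
  shows "Holder_dominated \<beta> 1 (return M x) (return M x)"
  unfolding Holder_dominated_def
proof safe
  fix f :: "'a \<Rightarrow> real"
  assume f: "f \<in> borel_measurable (return M x)" "\<forall>x. 0 \<le> f x \<and> f x \<le> 1"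
  have [measurable]: "f \<in> borel_measurable M" using f(1) by simp
  show "(\<integral>x. f x \<partial>return M x) \<le> 1 * (\<integral>x. f x powr \<beta> \<partial>return M x) powr (1 / \<beta>)"
    using assms f(2) by (simp add: integral_return powr_powr)
qed

lemma Holder_dominated_distr:
  assumes PQ: "Holder_dominated \<beta> c P Q" and s: "sets P = sets Q" and g: "g \<in> P \<rightarrow>\<^sub>M N"
  shows "Holder_dominated \<beta> c (distr P N g) (distr Q N g)"
  unfolding Holder_dominated_def
proof safe
  fix f :: "'b \<Rightarrow> real"
  assume f: "f \<in> borel_measurable (distr P N g)" "\<forall>x. 0 \<le> f x \<and> f x \<le> 1"
  have [measurable]: "f \<in> borel_measurable N" using f(1) by simp
  have [measurable]: "g \<in> P \<rightarrow>\<^sub>M N" "g \<in> Q \<rightarrow>\<^sub>M N" using g s by (auto cong: measurable_cong_sets)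
  have "(\<lambda>x. f (g x)) \<in> borel_measurable P" by measurable
  from Holder_dominatedD[OF PQ this] f(2)
  show "(\<integral>x. f x \<partial>distr P N g) \<le> c * (\<integral>x. f x powr \<beta> \<partial>distr Q N g) powr (1 / \<beta>)"
    by (simp add: integral_distr)
qed

lemma
  fixes f :: "'b \<Rightarrow> real"
  assumes P: "P \<in> space (prob_algebra M)" and K: "K \<in> M \<rightarrow>\<^sub>M prob_algebra N"
    and f: "f \<in> borel_measurable N" "\<And>x. 0 \<le> f x" "\<And>x. f x \<le> 1"
  shows integral_bind_prob: "(\<integral>y. f y \<partial>bind P K) = (\<integral>x. \<integral>y. f y \<partial>K x \<partial>P)"
    and integral_kernel_measurable: "(\<lambda>x. \<integral>y. f y \<partial>K x) \<in> borel_measurable M"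
    and integral_kernel_le_1: "x \<in> space M \<Longrightarrow> (\<integral>y. f y \<partial>K x) \<le> 1"
proof -
  have sP: "sets P = sets M" "prob_space P" using P by (auto simp: space_prob_algebra)
  have K': "K \<in> P \<rightarrow>\<^sub>M subprob_algebra N"
    using measurable_prob_algebraD[OF K] sP by (simp cong: measurable_cong_sets)
  show "(\<integral>y. f y \<partial>bind P K) = (\<integral>x. \<integral>y. f y \<partial>K x \<partial>P)"
  proof (rule integral_bind[OF f(1) _ K', of 1 1])
    show "finite_measure P" using sP(2) by (simp add: prob_space.finite_measure)
    show "AE x in P. emeasure (K x) (space (K x)) \<le> ennreal 1"
      using subprob_space_kernel[OF K'] by (auto simp: subprob_space.emeasure_space_le_1)
  qed (use f in auto)
  show "(\<lambda>x. \<integral>y. f y \<partial>K x) \<in> borel_measurable M"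
    by (rule measurable_compose[OF measurable_prob_algebraD[OF K] integral_measurable_subprob_algebra[OF f(1)]])
  show "(\<integral>y. f y \<partial>K x) \<le> 1" if "x \<in> space M"
  proof -
    have "K x \<in> space (prob_algebra N)" using measurable_space[OF K that] .
    then interpret prob_space "K x" by (simp add: space_prob_algebra)
    have "f \<in> borel_measurable (K x)"
      using f(1) \<open>K x \<in> space (prob_algebra N)\<close> by (simp add: space_prob_algebra cong: measurable_cong_sets)
    then have "integrable (K x) f"
      using f by (intro integrable_const_bound[where B = 1]) auto
    then show ?thesis using f by (intro integral_le_const) auto
  qed
qed

text \<open>The inner integral of f is at most c F, where F x is the L^\<beta> norm of f under L x.
  F is again a test function, and its \<beta>-th power integrates back to that of f under the
  composed measure. Almost everywhere is all that the application offers, since gradients are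
  controlled only at points of W.\<close>

lemma Holder_dominated_bind:
  assumes \<beta>: "0 < \<beta>" and c: "0 \<le> c"
    and P: "P \<in> space (prob_algebra M)" and Q: "Q \<in> space (prob_algebra M)"
    and K: "K \<in> M \<rightarrow>\<^sub>M prob_algebra N" and L: "L \<in> M \<rightarrow>\<^sub>M prob_algebra N"
    and PQ: "Holder_dominated \<beta> d P Q"
    and KL: "AE x in P. Holder_dominated \<beta> c (K x) (L x)"
  shows "Holder_dominated \<beta> (c * d) (bind P K) (bind Q L)"
  unfolding Holder_dominated_def
proof safe
  fix f :: "'b \<Rightarrow> real"
  assume f: "f \<in> borel_measurable (bind P K)" "\<forall>x. 0 \<le> f x \<and> f x \<le> 1"
  have sP: "sets P = sets M" "prob_space P" "sets Q = sets M" using P Q by (auto simp: space_prob_algebra)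
  interpret P: prob_space P by fact
  have spP: "space P = space M" "space Q = space M" using sP by (auto dest: sets_eq_imp_space_eq)
  have "sets (bind P K) = sets N"
    using P.not_empty measurable_space[OF K] spP
    by (intro sets_bind) (auto simp: space_prob_algebra)
  with f(1) have fN [measurable]: "f \<in> borel_measurable N" by (simp cong: measurable_cong_sets)
  have f01: "\<And>x. 0 \<le> f x" "\<And>x. f x \<le> 1" "\<And>x. f x powr \<beta> \<le> 1"
    using f(2) \<beta> by (auto simp: powr_le_one)
  have fb: "(\<lambda>x. f x powr \<beta>) \<in> borel_measurable N" by measurable
  \<comment> \<open>Set to 0 outside the space, where the kernel is uncontrolled: test functions
    must lie in [0, 1] at every point of the type.\<close>
  define F where "F x = (if x \<in> space M then (\<integral>y. f y powr \<beta> \<partial>L x) powr (1 / \<beta>) else 0)" for x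
  have "(\<lambda>x. (\<integral>y. f y powr \<beta> \<partial>L x) powr (1 / \<beta>)) \<in> borel_measurable M"
    using integral_kernel_measurable[OF Q L fb] f01 by simp
  then have F: "F \<in> borel_measurable M"
    by (subst measurable_cong[where g = "\<lambda>x. (\<integral>y. f y powr \<beta> \<partial>L x) powr (1 / \<beta>)"]) (auto simp: F_def)
  have F01: "0 \<le> F x" "F x \<le> 1" for x
    using integral_kernel_le_1[OF Q L fb, of x] f01 \<beta> by (auto simp: F_def intro!: powr_le_one)
  have iF: "integrable P F"
    using F F01 sP by (intro P.integrable_const_bound[where B = 1]) (auto cong: measurable_cong_sets)
  have le: "AE x in P. (\<integral>y. f y \<partial>K x) \<le> c * F x"
    using KL AE_space
  proof eventually_elim
    case (elim x)
    then have x: "x \<in> space M" using spP by simp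
    have "sets (K x) = sets N" using measurable_space[OF K x] by (simp add: space_prob_algebra)
    then have "f \<in> borel_measurable (K x)" by (simp cong: measurable_cong_sets)
    from Holder_dominatedD[OF elim(1) this] f01 x show ?case by (simp add: F_def)
  qed
  have "(\<integral>y. f y \<partial>bind P K) = (\<integral>x. \<integral>y. f y \<partial>K x \<partial>P)"
    using integral_bind_prob[OF P K fN] f01 by simp
  also have "\<dots> \<le> (\<integral>x. c * F x \<partial>P)"
    using le iF c F01 by (intro integral_mono_AE') auto
  also have "\<dots> = c * (\<integral>x. F x \<partial>P)" by simp
  also have "\<dots> \<le> c * (d * (\<integral>x. F x powr \<beta> \<partial>Q) powr (1 / \<beta>))"
    using F sP F01 c by (intro mult_left_mono Holder_dominatedD[OF PQ]) (auto cong: measurable_cong_sets)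
  also have "(\<integral>x. F x powr \<beta> \<partial>Q) = (\<integral>x. \<integral>y. f y powr \<beta> \<partial>L x \<partial>Q)"
    using \<beta> spP by (intro Bochner_Integration.integral_cong) (auto simp: F_def powr_powr)
  also have "\<dots> = (\<integral>y. f y powr \<beta> \<partial>bind Q L)"
    using integral_bind_prob[OF Q L fb] f01 by simp
  finally show "(\<integral>y. f y \<partial>bind P K) \<le> c * d * (\<integral>y. f y powr \<beta> \<partial>bind Q L) powr (1 / \<beta>)"
    by (simp add: mult.assoc)
qed

text \<open>The constant is the one that Hoelder's inequality yields from a Renyi divergence D. For
  an indicator, which equals its own powers, domination reads P(E) \<le> (exp D * Q(E))^((\<alpha> -
  1) / \<alpha>).\<close>

lemma Holder_dominated_measure:
  assumes \<alpha>: "1 < \<alpha>" and \<delta>: "0 < \<delta>"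
    and PQ: "Holder_dominated (\<alpha> / (\<alpha> - 1)) (exp ((\<alpha> - 1) / \<alpha> * D)) P Q"
    and E: "E \<in> sets P" "sets P = sets Q" and fin: "finite_measure P" "finite_measure Q"
  shows "measure P E \<le> exp (D + ln (1 / \<delta>) / (\<alpha> - 1)) * measure Q E + \<delta>"
proof -
  define \<gamma> where "\<gamma> = (\<alpha> - 1) / \<alpha>"
  have \<gamma>: "0 < \<gamma>" "\<gamma> < 1" using \<alpha> by (auto simp: \<gamma>_def)
  have "(\<lambda>x. indicator E x :: real) \<in> borel_measurable P" using E by simp
  from Holder_dominatedD[OF PQ this]
  have "(\<integral>x. indicator E x \<partial>P) \<le> exp (\<gamma> * D) * (\<integral>x. indicator E x powr (\<alpha> / (\<alpha> - 1)) \<partial>Q) powr \<gamma>"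
    by (simp add: \<gamma>_def)
  also have "(\<lambda>x. indicator E x powr (\<alpha> / (\<alpha> - 1))) = (\<lambda>x. indicator E x :: real)"
    by (auto simp: indicator_def)
  finally have le: "measure P E \<le> exp (\<gamma> * D) * measure Q E powr \<gamma>"
    using E by simp
  define X where "X = exp D * measure Q E"
  have X0: "0 \<le> X" by (simp add: X_def)
  have le': "measure P E \<le> X powr \<gamma>"
    using le by (simp add: X_def powr_mult exp_powr_real mult.commute)
  show ?thesis
    \<comment> \<open>If \<open>X \<le> \<delta> powr (1 / \<gamma>)\<close>, then \<open>X powr \<gamma> \<le> \<delta>\<close>; otherwise \<open>X powr (\<gamma> - 1)\<close> is at most its value there.\<close>
  proof (cases "X \<le> \<delta> powr (1 / \<gamma>)")
    case True
    then have "X powr \<gamma> \<le> (\<delta> powr (1 / \<gamma>)) powr \<gamma>" using X0 \<gamma> by (intro powr_mono2) auto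
    also have "\<dots> = \<delta>" using \<gamma> \<delta> by (simp add: powr_powr)
    finally have "measure P E \<le> \<delta>" using le' by linarith
    then show ?thesis by (simp add: add_increasing)
  next
    case False
    moreover have "0 < \<delta> powr (1 / \<gamma>)" using \<delta> by simp
    ultimately have X: "0 < X" "\<delta> powr (1 / \<gamma>) < X" by linarith+
    have "X powr (\<gamma> - 1) \<le> (\<delta> powr (1 / \<gamma>)) powr (\<gamma> - 1)"
      using X \<delta> \<gamma> by (intro powr_mono2') auto
    also have "\<dots> = exp (ln (1 / \<delta>) / (\<alpha> - 1))"
    proof -
      have "1 / \<gamma> * (\<gamma> - 1) = - (1 / (\<alpha> - 1))" using \<alpha> by (simp add: \<gamma>_def field_simps)
      then show ?thesis unfolding powr_powr using \<delta> by (simp only:) (simp add: powr_def ln_div)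
    qed
    finally have "X * X powr (\<gamma> - 1) \<le> X * exp (ln (1 / \<delta>) / (\<alpha> - 1))"
      using X by (intro mult_left_mono) auto
    moreover have "X * X powr (\<gamma> - 1) = X powr \<gamma>" using X by (simp add: powr_diff)
    ultimately have "measure P E \<le> X * exp (ln (1 / \<delta>) / (\<alpha> - 1))" using le' by linarith
    also have "\<dots> = exp (D + ln (1 / \<delta>) / (\<alpha> - 1)) * measure Q E"
      by (simp add: X_def exp_add mult_ac)
    finally show ?thesis using \<delta> by simp
  qed
qed

subsection \<open>Noisy gradient steps and trajectories\<close>

text \<open>Hoelder's inequality under the second mixture, applied to the ratio of the mixtures and
  h. The \<alpha>-th root cancels the factor \<alpha> in the exponent of the moment bound.\<close>

lemma gauss_mix_Holder:
  fixes a b b' :: "'a::euclidean_space"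
  assumes v: "0 < v"
    and close: "(b - a) \<bullet> (b - a) \<le> s * v" "(b' - a) \<bullet> (b' - a) \<le> s * v" "(b - b') \<bullet> (b - b') \<le> s * v"
    and s: "0 < s" "s \<le> 1.4926" and p: "0 < p" "p < 1" and \<alpha>: "1 < \<alpha>"
    and cond: "\<alpha> * p * exp (1.5 * s * (\<alpha> - 1)) \<le> s / (1 + s)"
    and h [measurable]: "h \<in> borel_measurable borel" and h01: "\<And>x. 0 \<le> h x" "\<And>x. h x \<le> 1"
  defines "\<beta> \<equiv> \<alpha> / (\<alpha> - 1)"
  shows "(\<integral>x. gauss_mix v p a b x * h x \<partial>lborel)
    \<le> exp (3.5 * p\<^sup>2 * (\<alpha> - 1) * s) * (\<integral>x. gauss_mix v p a b' x * h x powr \<beta> \<partial>lborel) powr (1 / \<beta>)"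
proof -
  let ?P = "gauss_mix v p a b" and ?Q = "gauss_mix v p a b'"
  have pos: "0 < ?P x" "0 < ?Q x" for x using gauss_mix_pos[OF v p] by auto
  have nn: "AE x in lborel. 0 \<le> ?Q x" using pos by (auto simp: less_imp_le)
  define M where "M = density lborel (\<lambda>x. ennreal (?Q x))"
  have int: "(\<integral>x. f x \<partial>M) = (\<integral>x. ?Q x * f x \<partial>lborel)"
    if [measurable]: "f \<in> borel_measurable borel" for f :: "'a \<Rightarrow> real"
    unfolding M_def using nn by (subst integral_density) auto
  have integrable: "integrable M f \<longleftrightarrow> integrable lborel (\<lambda>x. ?Q x * f x)"
    if [measurable]: "f \<in> borel_measurable borel" for f :: "'a \<Rightarrow> real"
    unfolding M_def using nn by (subst integrable_density) auto
  have \<beta>: "1 < \<beta>" "1 / \<alpha> + 1 / \<beta> = 1" using \<alpha> by (auto simp: \<beta>_def field_simps)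
  note moment = gauss_mix_moment[OF v close s p \<alpha> cond]
  have iQ: "integrable lborel ?Q"
    using has_integral_gauss_density[OF v, of a] has_integral_gauss_density[OF v, of b']
    unfolding gauss_mix_def by (auto simp: has_bochner_integral_iff)
  have "integrable lborel (\<lambda>x. ?Q x * h x powr \<beta>)"
  proof (rule Bochner_Integration.integrable_bound[OF iQ])
    show "AE x in lborel. norm (?Q x * h x powr \<beta>) \<le> norm (?Q x)"
      using h01 \<beta> by (intro AE_I2) (auto simp: abs_mult intro!: mult_left_le powr_le_one)
  qed measurable
  then have iw: "integrable M (\<lambda>x. h x powr \<beta>)" by (subst integrable) auto
  have iu: "integrable M (\<lambda>x. (?P x / ?Q x) powr \<alpha>)"
    using moment by (subst integrable) (auto simp: mult.commute)
  have "(\<integral>x. ?P x * h x \<partial>lborel) = (\<integral>x. ?Q x * (?P x / ?Q x * h x) \<partial>lborel)"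
    using pos(2) by (intro Bochner_Integration.integral_cong) (auto simp: less_imp_neq[symmetric])
  also have "\<dots> = (\<integral>x. ?P x / ?Q x * h x \<partial>M)" by (subst int) auto
  also have "\<dots> \<le> (\<integral>x. (?P x / ?Q x) powr \<alpha> \<partial>M) powr (1 / \<alpha>) * (\<integral>x. h x powr \<beta> \<partial>M) powr (1 / \<beta>)"
    using \<alpha> \<beta> h01 pos iu iw by (intro Holder_integral) (auto simp: M_def less_imp_le)
  also have "(\<integral>x. h x powr \<beta> \<partial>M) = (\<integral>x. ?Q x * h x powr \<beta> \<partial>lborel)" by (subst int) auto
  also have "(\<integral>x. (?P x / ?Q x) powr \<alpha> \<partial>M) powr (1 / \<alpha>) \<le> exp (3.5 * p\<^sup>2 * \<alpha> * (\<alpha> - 1) * s) powr (1 / \<alpha>)"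
  proof (rule powr_mono2)
    show "(\<integral>x. (?P x / ?Q x) powr \<alpha> \<partial>M) \<le> exp (3.5 * p\<^sup>2 * \<alpha> * (\<alpha> - 1) * s)"
      using moment by (subst int) (auto simp: mult.commute)
  qed (use \<alpha> in auto)
  also have "exp (3.5 * p\<^sup>2 * \<alpha> * (\<alpha> - 1) * s) powr (1 / \<alpha>) = exp (3.5 * p\<^sup>2 * (\<alpha> - 1) * s)"
    using \<alpha> by (simp add: exp_powr_real)
  finally show ?thesis by (simp add: mult_right_mono)
qed

text \<open>The coupling: k and l are drawn independently from U and V, and mixing them with weight
  p, the proportion of V, restores the uniform distribution on the union.\<close>

lemma sum_Un_eq_mixture:
  fixes I :: "'b \<Rightarrow> real"
  assumes fin: "finite U" "finite V" and ne: "U \<noteq> {}" "V \<noteq> {}" and dis: "U \<inter> V = {}"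
    and p: "p = card V / card (U \<union> V)"
  shows "sum I (U \<union> V) / card (U \<union> V)
    = (\<Sum>(k, l)\<in>U \<times> V. (1 - p) * I k + p * I l) / card (U \<times> V)"
proof -
  have c: "real (card (U \<union> V)) = card U + card V" "0 < card U" "0 < card V"
    using assms by (auto simp: card_Un_disjoint card_gt_0_iff)
  have 1: "1 - p = card U / card (U \<union> V)" using c by (simp add: p field_simps)
  have "(\<Sum>(k, l)\<in>U \<times> V. (1 - p) * I k + p * I l)
      = card V * (1 - p) * sum I U + card U * p * sum I V"
    by (simp add: sum.cartesian_product[symmetric] sum.distrib sum_distrib_left sum_distrib_right mult_ac)
  also have "\<dots> = real (card U) * card V * (sum I U + sum I V) / card (U \<union> V)"
    unfolding 1 unfolding p by (simp add: add_divide_distrib algebra_simps)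
  finally show ?thesis using c assms by (simp add: sum.union_disjoint card_cartesian_product)
qed

text \<open>Jensen's inequality for a concave root, as Hoelder's inequality against the constant 1.
  It passes from dominations for single couples (k, l) to their average without loss in the
  constant.\<close>

lemma mean_powr_le:
  fixes t :: "'b \<Rightarrow> real"
  assumes \<beta>: "1 < \<beta>" and A: "finite A" "A \<noteq> {}" and t: "\<And>i. 0 \<le> t i"
  shows "(\<Sum>i\<in>A. t i powr (1 / \<beta>)) / card A \<le> ((\<Sum>i\<in>A. t i) / card A) powr (1 / \<beta>)"
proof -
  define \<alpha> where "\<alpha> = \<beta> / (\<beta> - 1)"
  have \<alpha>: "1 < \<alpha>" "1 / \<alpha> + 1 / \<beta> = 1" using \<beta> by (auto simp: \<alpha>_def field_simps)
  let ?M = "measure_pmf (pmf_of_set A)"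
  have i: "integrable ?M f" for f :: "'b \<Rightarrow> real"
    using A by (intro integrable_measure_pmf_finite) simp
  have "(\<integral>i. 1 * t i powr (1 / \<beta>) \<partial>?M)
      \<le> (\<integral>i. 1 powr \<alpha> \<partial>?M) powr (1 / \<alpha>) * (\<integral>i. (t i powr (1 / \<beta>)) powr \<beta> \<partial>?M) powr (1 / \<beta>)"
    using \<alpha> \<beta> by (intro Holder_integral i) auto
  then show ?thesis using A t \<beta> by (simp add: powr_powr integral_pmf_of_set)
qed

section \<open>Counting ordered index pairs\<close>

lemma finite_ordered_pairs [simp]: "finite (ordered_pairs n)"
  by (rule finite_subset[of _ "{..<n} \<times> {..<n}"]) (auto simp: ordered_pairs_def)

lemma card_ordered_pairs: "card (ordered_pairs n) = n * (n - 1)"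
proof -
  have "ordered_pairs n = (SIGMA i:{..<n}. {..<n} - {i})" by (auto simp: ordered_pairs_def)
  then show ?thesis by simp
qed

text \<open>Both positions count, so a sampled pair contains a given index with probability 2 (n -
  1) / (n (n - 1)) = 2 / n.\<close>

lemma card_ordered_pairs_containing:
  assumes "m < n"
  shows "card {(i, j) \<in> ordered_pairs n. i = m \<or> j = m} = 2 * (n - 1)"
proof -
  have eq: "{(i, j) \<in> ordered_pairs n. i = m \<or> j = m} = {m} \<times> ({..<n} - {m}) \<union> ({..<n} - {m}) \<times> {m}"
    using assms by (auto simp: ordered_pairs_def)
  show ?thesis unfolding eq using assms by (subst card_Un_disjoint) auto
qed

section \<open>Kernels of the algorithm: measurability, integrals and support\<close>

context
  fixes W :: "'a::euclidean_space set" and g :: "'a \<Rightarrow> 'z \<Rightarrow> 'z \<Rightarrow> 'a" and eta :: "nat \<Rightarrow> real" and v :: real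
  assumes W: "convex W" "closed W" "0 \<in> W"
    and g: "\<And>z z'. (\<lambda>w. g w z z') \<in> borel_measurable borel" and v: "0 < v"
begin

lemma borel_measurable_closest_point [measurable]: "closest_point W \<in> borel_measurable borel"
  using W by (intro borel_measurable_continuous_onI continuous_on_closest_point) auto

lemma gauss_noise_in_prob_algebra: "(\<lambda>_. gauss_noise v) \<in> M \<rightarrow>\<^sub>M prob_algebra borel"
  by (intro measurable_const) (simp add: space_prob_algebra sets_gauss_noise prob_space_gauss_noise[OF v])

text \<open>Index pairs form a countable discrete space, so joint measurability reduces to
  measurability in w for each fixed pair.\<close>

lemma update_kernel_measurable:
  "(\<lambda>(w, i, j). bind (gauss_noise v)
      (\<lambda>b. return borel (closest_point W (w - eta t *\<^sub>R (g w (S ! i) (S ! j) + b)))))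
    \<in> borel \<Otimes>\<^sub>M count_space UNIV \<rightarrow>\<^sub>M prob_algebra borel"
proof -
  have "(\<lambda>w. bind (gauss_noise v)
      (\<lambda>b. return borel (closest_point W (w - eta t *\<^sub>R (g w (S ! i) (S ! j) + b)))))
    \<in> borel \<rightarrow>\<^sub>M prob_algebra borel" for i j
  proof (rule measurable_bind_prob_space2[OF gauss_noise_in_prob_algebra])
    note g [measurable]
    show "(\<lambda>(w, b). return borel (closest_point W (w - eta t *\<^sub>R (g w (S ! i) (S ! j) + b))))
      \<in> borel \<Otimes>\<^sub>M borel \<rightarrow>\<^sub>M prob_algebra borel"
      by measurable
  qed
  then have "(\<lambda>(ij, w). bind (gauss_noise v)
      (\<lambda>b. return borel (closest_point W (w - eta t *\<^sub>R (g w (S ! fst ij) (S ! snd ij) + b)))))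
    \<in> count_space (UNIV :: (nat \<times> nat) set) \<Otimes>\<^sub>M borel \<rightarrow>\<^sub>M prob_algebra borel"
    by (intro measurable_pair_measure_countable1) auto
  from measurable_compose[OF measurable_pair_swap' this] show ?thesis
    by (simp add: case_prod_beta)
qed

lemma dpsgd_step_measurable: "dpsgd_step W g eta v S t \<in> borel \<rightarrow>\<^sub>M prob_algebra borel"
  unfolding dpsgd_step_def
proof (rule measurable_bind_prob_space2)
  show "(\<lambda>w. measure_pmf (pmf_of_set (ordered_pairs (length S)))) \<in> borel \<rightarrow>\<^sub>M prob_algebra (count_space UNIV)"
    by (intro measurable_const) (simp add: space_prob_algebra prob_space_measure_pmf)
qed (rule update_kernel_measurable)

text \<open>Step size and projection move into the test function; only the centres of the Gaussian
  densities still depend on the dataset.\<close>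

lemma integral_dpsgd_step:
  fixes f :: "'a \<Rightarrow> real"
  assumes n: "2 \<le> length S" and f [measurable]: "f \<in> borel_measurable borel"
    and f01: "\<And>x. 0 \<le> f x" "\<And>x. f x \<le> 1"
  shows "(\<integral>x. f x \<partial>dpsgd_step W g eta v S t w)
    = (\<Sum>(i, j)\<in>ordered_pairs (length S). \<integral>x. gauss_density v (g w (S ! i) (S ! j)) x
        * f (closest_point W (w - eta t *\<^sub>R x)) \<partial>lborel) / card (ordered_pairs (length S))"
proof -
  let ?K = "\<lambda>(i, j). bind (gauss_noise v)
      (\<lambda>b. return borel (closest_point W (w - eta t *\<^sub>R (g w (S ! i) (S ! j) + b))))"
  have K: "?K \<in> count_space UNIV \<rightarrow>\<^sub>M prob_algebra borel"
    using measurable_compose[OF measurable_Pair1'[of w borel "count_space UNIV"] update_kernel_measurable[of t S]]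
    by simp
  have ne: "ordered_pairs (length S) \<noteq> {}"
  proof -
    have "(0, 1) \<in> ordered_pairs (length S)" using n by (auto simp: ordered_pairs_def)
    then show ?thesis by blast
  qed
  have inner: "(\<integral>x. f x \<partial>?K (i, j)) = (\<integral>x. gauss_density v (g w (S ! i) (S ! j)) x
        * f (closest_point W (w - eta t *\<^sub>R x)) \<partial>lborel)" for i j
  proof -
    have "(\<integral>x. f x \<partial>?K (i, j))
        = (\<integral>b. \<integral>x. f x \<partial>return borel (closest_point W (w - eta t *\<^sub>R (g w (S ! i) (S ! j) + b))) \<partial>gauss_noise v)"
      unfolding prod.case
    proof (rule integral_bind_prob[OF _ _ f f01])
      show "gauss_noise v \<in> space (prob_algebra borel)"
        by (simp add: space_prob_algebra sets_gauss_noise prob_space_gauss_noise[OF v])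
      show "(\<lambda>b. return borel (closest_point W (w - eta t *\<^sub>R (g w (S ! i) (S ! j) + b))))
        \<in> borel \<rightarrow>\<^sub>M prob_algebra borel"
        by measurable
    qed
    also have "\<dots> = (\<integral>b. f (closest_point W (w - eta t *\<^sub>R (g w (S ! i) (S ! j) + b))) \<partial>gauss_noise v)"
      by (simp add: integral_return)
    also have "\<dots> = (\<integral>x. gauss_density v (g w (S ! i) (S ! j)) x
        * f (closest_point W (w - eta t *\<^sub>R x)) \<partial>lborel)"
      by (rule integral_gauss_noise_shift[OF v, of "\<lambda>x. f (closest_point W (w - eta t *\<^sub>R x))"]) measurable
    finally show ?thesis .
  qed
  have "(\<integral>x. f x \<partial>dpsgd_step W g eta v S t w)
      = (\<integral>ij. \<integral>x. f x \<partial>?K ij \<partial>measure_pmf (pmf_of_set (ordered_pairs (length S))))"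
    unfolding dpsgd_step_def
    by (rule integral_bind_prob[OF _ K f f01]) (simp add: space_prob_algebra prob_space_measure_pmf)
  also have "\<dots> = (\<Sum>ij\<in>ordered_pairs (length S). \<integral>x. f x \<partial>?K ij) / card (ordered_pairs (length S))"
    using ne by (subst integral_pmf_of_set) auto
  also have "(\<Sum>ij\<in>ordered_pairs (length S). \<integral>x. f x \<partial>?K ij)
      = (\<Sum>(i, j)\<in>ordered_pairs (length S). \<integral>x. gauss_density v (g w (S ! i) (S ! j)) x
        * f (closest_point W (w - eta t *\<^sub>R x)) \<partial>lborel)"
  proof (rule sum.cong[OF refl])
    fix ij
    show "(\<integral>x. f x \<partial>?K ij) = (case ij of (i, j) \<Rightarrow> \<integral>x. gauss_density v (g w (S ! i) (S ! j)) x
        * f (closest_point W (w - eta t *\<^sub>R x)) \<partial>lborel)"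
      by (cases ij) (simp only: inner[unfolded prod.case] prod.case)
  qed
  finally show ?thesis .
qed

lemma dpsgd_step_AE: "AE x in dpsgd_step W g eta v S t w. x \<in> W"
proof -
  have W': "closest_point W x \<in> W" for x using W by (intro closest_point_in_set) auto
  have [measurable]: "W \<in> sets borel" using W by auto
  let ?K = "\<lambda>(i, j). bind (gauss_noise v)
      (\<lambda>b. return borel (closest_point W (w - eta t *\<^sub>R (g w (S ! i) (S ! j) + b))))"
  have K: "?K \<in> count_space UNIV \<rightarrow>\<^sub>M prob_algebra borel"
    using measurable_compose[OF measurable_Pair1'[of w borel "count_space UNIV"] update_kernel_measurable[of t S]]
    by simp
  have "AE x in ?K (i, j). x \<in> W" for i j
    unfolding prod.case
    by (subst AE_bind[where B = borel]) (auto simp: AE_return W')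
  moreover have "?K \<in> measure_pmf (pmf_of_set (ordered_pairs (length S))) \<rightarrow>\<^sub>M subprob_algebra borel"
    using measurable_prob_algebraD[OF K] by simp
  ultimately show ?thesis
    unfolding dpsgd_step_def by (subst AE_bind[where B = borel]) auto
qed

lemma dpsgd_traj_kernel_measurable:
  "(\<lambda>(w, acc). distr (dpsgd_step W g eta v S t w) borel (\<lambda>w'. (w', acc + w)))
    \<in> (borel :: ('a \<times> 'a) measure) \<rightarrow>\<^sub>M prob_algebra borel"
proof -
  note dpsgd_step_measurable[of S t, measurable]
  have "(\<lambda>x. distr (dpsgd_step W g eta v S t (fst x)) (borel \<Otimes>\<^sub>M borel) (\<lambda>w'. (w', snd x + fst x)))
    \<in> (borel \<Otimes>\<^sub>M borel :: ('a \<times> 'a) measure) \<rightarrow>\<^sub>M prob_algebra (borel \<Otimes>\<^sub>M borel)"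
    by measurable
  then show ?thesis by (simp add: borel_prod case_prod_beta)
qed

lemma dpsgd_traj_in_prob_algebra: "dpsgd_traj W g eta v S k \<in> space (prob_algebra borel)"
proof (induction k)
  case 0
  then show ?case by (simp add: space_prob_algebra prob_space_return)
next
  case (Suc k)
  have "(\<lambda>_. bind (dpsgd_traj W g eta v S k)
        (\<lambda>(w, acc). distr (dpsgd_step W g eta v S (Suc k) w) borel (\<lambda>w'. (w', acc + w))))
      \<in> count_space (UNIV :: unit set) \<rightarrow>\<^sub>M prob_algebra borel"
    by (rule measurable_bind_prob_space[OF measurable_const[OF Suc] dpsgd_traj_kernel_measurable])
  from measurable_space[OF this, of "()"] show ?case by simp
qed

text \<open>The projection keeps the iterates in W and the start 0 belongs to W, so the gradient
  bounds apply along almost every trajectory.\<close>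

lemma dpsgd_traj_AE: "AE x in dpsgd_traj W g eta v S k. fst x \<in> W"
proof -
  have fst_W [measurable]: "Measurable.pred borel (\<lambda>x::'a \<times> 'a. fst x \<in> W)"
  proof -
    have "W \<in> sets borel" using W by auto
    then have "Measurable.pred (borel \<Otimes>\<^sub>M borel) (\<lambda>x::'a \<times> 'a. fst x \<in> W)" by measurable
    then show ?thesis by (simp add: borel_prod)
  qed
  show ?thesis
  proof (cases k)
    case 0
    show ?thesis unfolding 0 dpsgd_traj.simps by (subst AE_return) (use W fst_W in auto)
  next
    case (Suc j)
    have "sets (dpsgd_traj W g eta v S j) = sets borel"
      using dpsgd_traj_in_prob_algebra[of S j] by (simp add: space_prob_algebra)
    then have K: "(\<lambda>(w, acc). distr (dpsgd_step W g eta v S k w) borel (\<lambda>w'. (w', acc + w)))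
        \<in> dpsgd_traj W g eta v S j \<rightarrow>\<^sub>M subprob_algebra borel"
      using measurable_prob_algebraD[OF dpsgd_traj_kernel_measurable[of S k]]
      by (simp cong: measurable_cong_sets)
    have "AE x in distr (dpsgd_step W g eta v S k w) borel (\<lambda>w'. (w', acc + w)). fst x \<in> W" for w acc
    proof -
      have "sets (dpsgd_step W g eta v S k w) = sets borel"
        using measurable_space[OF dpsgd_step_measurable[of S k], of w] by (simp add: space_prob_algebra)
      then have "(\<lambda>w'. (w', acc + w)) \<in> dpsgd_step W g eta v S k w \<rightarrow>\<^sub>M borel"
        by (simp cong: measurable_cong_sets)
      then show ?thesis
        using dpsgd_step_AE[of S k w] by (subst AE_distr_iff) auto
    qed
    then show ?thesis
      unfolding Suc dpsgd_traj.simps by (subst AE_bind[OF K[unfolded Suc] fst_W]) auto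
  qed
qed

section \<open>Neighbouring datasets: one step, the trajectory and the output\<close>

context
  fixes S S' :: "'z list" and n m :: nat and p s \<alpha> :: real
  assumes n: "2 < n" and len: "length S = n" "length S' = n"
    and m: "m < n" and eq: "\<And>i. i < n \<Longrightarrow> i \<noteq> m \<Longrightarrow> S ! i = S' ! i"
    and diameter: "\<And>w i j k l. w \<in> W \<Longrightarrow> i < n \<Longrightarrow> j < n \<Longrightarrow> k < n \<Longrightarrow> l < n \<Longrightarrow>
      \<forall>x \<in> {g w (S ! i) (S ! j), g w (S' ! i) (S' ! j)}. \<forall>y \<in> {g w (S ! k) (S ! l), g w (S' ! k) (S' ! l)}.
        (x - y) \<bullet> (x - y) \<le> s * v"
    and s: "0 < s" "s \<le> 1.4926" and p: "p = 2 / n" and \<alpha>: "1 < \<alpha>"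
    and cond: "\<alpha> * p * exp (1.5 * s * (\<alpha> - 1)) \<le> s / (1 + s)"
begin

lemma dpsgd_step_Holder_dominated:
  assumes w: "w \<in> W"
  shows "Holder_dominated (\<alpha> / (\<alpha> - 1)) (exp (3.5 * p\<^sup>2 * (\<alpha> - 1) * s))
    (dpsgd_step W g eta v S t w) (dpsgd_step W g eta v S' t w)"
  unfolding Holder_dominated_def
proof safe
  fix f :: "'a \<Rightarrow> real"
  assume f: "f \<in> borel_measurable (dpsgd_step W g eta v S t w)" "\<forall>x. 0 \<le> f x \<and> f x \<le> 1"
  have "sets (dpsgd_step W g eta v S t w) = sets borel"
    using measurable_space[OF dpsgd_step_measurable[of S t], of w] by (simp add: space_prob_algebra)
  then have fm [measurable]: "f \<in> borel_measurable borel" using f(1) by (simp cong: measurable_cong_sets)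
  define \<beta> where "\<beta> = \<alpha> / (\<alpha> - 1)"
  have \<beta>: "1 < \<beta>" using \<alpha> by (simp add: \<beta>_def field_simps)
  let ?c = "exp (3.5 * p\<^sup>2 * (\<alpha> - 1) * s)"
  define h where "h x = f (closest_point W (w - eta t *\<^sub>R x))" for x
  have h [measurable]: "h \<in> borel_measurable borel"
    unfolding h_def using borel_measurable_closest_point by measurable
  have h01: "0 \<le> h x" "h x \<le> 1" for x using f(2) by (auto simp: h_def)
  define a b where "a = (\<lambda>(i, j). g w (S ! i) (S ! j))" and "b = (\<lambda>(i, j). g w (S' ! i) (S' ! j))"
  define V U where "V = {(i, j) \<in> ordered_pairs n. i = m \<or> j = m}" and "U = ordered_pairs n - V"
  have UV: "U \<union> V = ordered_pairs n" "U \<inter> V = {}" by (auto simp: U_def V_def)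
  have fin: "finite U" "finite V" by (auto simp: U_def V_def intro: finite_subset[OF _ finite_ordered_pairs[of n]])
  have cV: "card V = 2 * (n - 1)" unfolding V_def using m by (rule card_ordered_pairs_containing)
  have cUV: "card (U \<union> V) = n * (n - 1)" by (simp add: UV card_ordered_pairs)
  have "card (U \<union> V) = card U + card V" by (rule card_Un_disjoint[OF fin UV(2)])
  then have cU: "card U = (n - 2) * (n - 1)" using cV cUV by (simp add: diff_mult_distrib)
  \<comment> \<open>Pairs avoiding m exist only because n > 2.\<close>
  have ne: "U \<noteq> {}" "V \<noteq> {}" using cU cV n by auto
  have pUV: "p = card V / card (U \<union> V)" using n by (simp add: p cV cUV of_nat_diff field_simps)
  have p01: "0 < p" "p < 1" using n by (auto simp: p)
  \<comment> \<open>Such a pair reads the same data points in both datasets, so its Gaussian serves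
    as the common component A.\<close>
  have ab: "a k = b k" if k: "k \<in> U" for k
  proof -
    obtain i j where "k = (i, j)" "i < n" "j < n" "i \<noteq> m" "j \<noteq> m"
      using k by (auto simp: U_def V_def ordered_pairs_def)
    then show ?thesis using eq[of i] eq[of j] by (simp add: a_def b_def)
  qed
  \<comment> \<open>General in dataset and test function because it is used twice: for S with f, and
    for S' with the power of f.\<close>
  have step: "(\<integral>x. F x \<partial>dpsgd_step W g eta v R t w)
      = (\<Sum>(k, l)\<in>U \<times> V. \<integral>x. gauss_mix v p (c k) (c l) x * F (closest_point W (w - eta t *\<^sub>R x)) \<partial>lborel)
        / card (U \<times> V)"
    if F: "F \<in> borel_measurable borel" "\<And>x. 0 \<le> F x" "\<And>x. F x \<le> 1" and R: "length R = n"
      and c: "c = (\<lambda>(i, j). g w (R ! i) (R ! j))" for F R c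
  proof -
    define H where "H x = F (closest_point W (w - eta t *\<^sub>R x))" for x
    have H: "H \<in> borel_measurable borel"
      unfolding H_def using borel_measurable_closest_point F(1) by measurable
    have H01: "0 \<le> H x" "H x \<le> 1" for x using F by (auto simp: H_def)
    define I where "I k = (\<integral>x. gauss_density v (c k) x * H x \<partial>lborel)" for k
    have iI: "integrable lborel (\<lambda>x. gauss_density v \<mu> x * H x)" for \<mu>
    proof (rule Bochner_Integration.integrable_bound)
      show "integrable lborel (gauss_density v \<mu>)"
        using has_integral_gauss_density[OF v] by (auto simp: has_bochner_integral_iff)
      show "AE x in lborel. norm (gauss_density v \<mu> x * H x) \<le> norm (gauss_density v \<mu> x)"
        using H01 by (intro AE_I2) (auto simp: abs_mult intro!: mult_left_le)
    qed (use H in measurable)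
    have "(\<integral>x. F x \<partial>dpsgd_step W g eta v R t w) = sum I (U \<union> V) / card (U \<union> V)"
      using integral_dpsgd_step[OF _ F, of R t w] n R
      by (simp add: UV I_def H_def c case_prod_beta)
    also have "\<dots> = (\<Sum>(k, l)\<in>U \<times> V. (1 - p) * I k + p * I l) / card (U \<times> V)"
      by (rule sum_Un_eq_mixture[OF fin ne UV(2) pUV])
    also have "(\<Sum>(k, l)\<in>U \<times> V. (1 - p) * I k + p * I l)
        = (\<Sum>(k, l)\<in>U \<times> V. \<integral>x. gauss_mix v p (c k) (c l) x * H x \<partial>lborel)"
    proof (rule sum.cong, safe)
      fix i j i' j'
      have "(\<integral>x. gauss_mix v p (c (i, j)) (c (i', j')) x * H x \<partial>lborel)
          = (\<integral>x. (1 - p) * (gauss_density v (c (i, j)) x * H x) + p * (gauss_density v (c (i', j')) x * H x) \<partial>lborel)"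
        by (simp add: gauss_mix_def algebra_simps)
      also have "\<dots> = (1 - p) * I (i, j) + p * I (i', j')" using iI by (simp add: I_def)
      finally show "(1 - p) * I (i, j) + p * I (i', j')
          = (\<integral>x. gauss_mix v p (c (i, j)) (c (i', j')) x * H x \<partial>lborel)" by simp
    qed
    finally show ?thesis by (simp add: H_def)
  qed
  define J where "J = (\<lambda>(k, l). \<integral>x. gauss_mix v p (b k) (b l) x * h x powr \<beta> \<partial>lborel)"
  have J0: "0 \<le> J kl" for kl
  proof -
    have "0 \<le> gauss_mix v p \<mu> \<nu> x" for \<mu> \<nu> x :: 'a
      using gauss_mix_pos[OF v p01, of \<mu> \<nu> x] by simp
    then show ?thesis by (simp add: J_def case_prod_beta)
  qed
  have le: "(\<integral>x. gauss_mix v p (a k) (a l) x * h x \<partial>lborel) \<le> ?c * J (k, l) powr (1 / \<beta>)"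
    if kl: "k \<in> U" "l \<in> V" for k l
  proof -
    obtain i j i' j' where e: "k = (i, j)" "l = (i', j')" by (cases k, cases l) auto
    have lt: "i < n" "j < n" "i' < n" "j' < n" using kl by (auto simp: e U_def V_def ordered_pairs_def)
    \<comment> \<open>A is centred at b k, B at a l and B' at b l. The first two distances compare
      the pairs l and k, the third compares l with itself across the datasets.\<close>
    have "(a l - b k) \<bullet> (a l - b k) \<le> s * v" "(b l - b k) \<bullet> (b l - b k) \<le> s * v" "(a l - b l) \<bullet> (a l - b l) \<le> s * v"
      using diameter[OF w lt(3,4,1,2)] diameter[OF w lt(3,4,3,4)] by (auto simp: e a_def b_def)
    from gauss_mix_Holder[OF v this s p01 \<alpha> cond h h01] show ?thesis
      by (simp add: J_def ab[OF kl(1)] \<beta>_def)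
  qed
  have "(\<integral>x. f x \<partial>dpsgd_step W g eta v S t w)
      = (\<Sum>(k, l)\<in>U \<times> V. \<integral>x. gauss_mix v p (a k) (a l) x * h x \<partial>lborel) / card (U \<times> V)"
    unfolding h_def using f(2) by (intro step fm len(1) a_def) auto
  also have "\<dots> \<le> (\<Sum>kl\<in>U \<times> V. ?c * J kl powr (1 / \<beta>)) / card (U \<times> V)"
    using le by (intro divide_right_mono sum_mono) auto
  also have "\<dots> = ?c * ((\<Sum>kl\<in>U \<times> V. J kl powr (1 / \<beta>)) / card (U \<times> V))"
    by (simp add: sum_distrib_left)
  also have "\<dots> \<le> ?c * ((\<Sum>kl\<in>U \<times> V. J kl) / card (U \<times> V)) powr (1 / \<beta>)"
    using \<beta> fin ne J0 by (intro mult_left_mono mean_powr_le) auto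
  also have "(\<Sum>kl\<in>U \<times> V. J kl) / card (U \<times> V) = (\<integral>x. f x powr \<beta> \<partial>dpsgd_step W g eta v S' t w)"
  proof -
    have "(\<integral>x. f x powr \<beta> \<partial>dpsgd_step W g eta v S' t w)
      = (\<Sum>(k, l)\<in>U \<times> V. \<integral>x. gauss_mix v p (b k) (b l) x * f (closest_point W (w - eta t *\<^sub>R x)) powr \<beta> \<partial>lborel)
        / card (U \<times> V)"
      using f(2) \<beta> by (intro step len(2) b_def) (auto intro!: powr_le_one)
    then show ?thesis by (simp add: J_def h_def)
  qed
  finally show "(\<integral>x. f x \<partial>dpsgd_step W g eta v S t w)
      \<le> ?c * (\<integral>x. f x powr (\<alpha> / (\<alpha> - 1)) \<partial>dpsgd_step W g eta v S' t w) powr (1 / (\<alpha> / (\<alpha> - 1)))"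
    by (simp add: \<beta>_def)
qed

text \<open>The constant of one step depends neither on the current point of W nor on the step size,
  so adaptive composition merely multiplies it.\<close>

lemma dpsgd_traj_Holder_dominated:
  "Holder_dominated (\<alpha> / (\<alpha> - 1)) (exp (3.5 * p\<^sup>2 * (\<alpha> - 1) * s) ^ k)
    (dpsgd_traj W g eta v S k) (dpsgd_traj W g eta v S' k)"
proof (induction k)
  case 0
  then show ?case using \<alpha> by (simp add: Holder_dominated_return)
next
  case (Suc k)
  let ?c = "exp (3.5 * p\<^sup>2 * (\<alpha> - 1) * s)"
  have "AE x in dpsgd_traj W g eta v S k. Holder_dominated (\<alpha> / (\<alpha> - 1)) ?c
      (case x of (w, acc) \<Rightarrow> distr (dpsgd_step W g eta v S (Suc k) w) borel (\<lambda>w'. (w', acc + w)))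
      (case x of (w, acc) \<Rightarrow> distr (dpsgd_step W g eta v S' (Suc k) w) borel (\<lambda>w'. (w', acc + w)))"
    using dpsgd_traj_AE
  proof eventually_elim
    case (elim x)
    have sets: "sets (dpsgd_step W g eta v R t w) = sets borel" for R t w
      using measurable_space[OF dpsgd_step_measurable[of R t], of w] by (simp add: space_prob_algebra)
    obtain w acc where x: "x = (w, acc)" by (cases x)
    have "(\<lambda>w'. (w', acc + w)) \<in> dpsgd_step W g eta v S (Suc k) w \<rightarrow>\<^sub>M borel"
      by (simp add: sets cong: measurable_cong_sets)
    then show ?case
      unfolding x prod.case using elim x
      by (intro Holder_dominated_distr dpsgd_step_Holder_dominated) (auto simp: sets)
  qed
  then show ?case
    using \<alpha> Suc unfolding dpsgd_traj.simps power_Suc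
    by (intro Holder_dominated_bind[OF _ _ dpsgd_traj_in_prob_algebra dpsgd_traj_in_prob_algebra
          dpsgd_traj_kernel_measurable dpsgd_traj_kernel_measurable]) auto
qed

lemma dpsgd_Holder_dominated:
  "Holder_dominated (\<alpha> / (\<alpha> - 1)) (exp (3.5 * p\<^sup>2 * (\<alpha> - 1) * s) ^ T)
    (dpsgd W g eta v S T) (dpsgd W g eta v S' T)"
  unfolding dpsgd_def
proof (rule Holder_dominated_distr[OF dpsgd_traj_Holder_dominated])
  have sets: "sets (dpsgd_traj W g eta v R T) = sets borel" for R
    using dpsgd_traj_in_prob_algebra[of R T] by (simp add: space_prob_algebra)
  then show "sets (dpsgd_traj W g eta v S T) = sets (dpsgd_traj W g eta v S' T)" by simp
  have "(\<lambda>(w, acc). (1 / real T) *\<^sub>R acc) \<in> (borel :: ('a \<times> 'a) measure) \<rightarrow>\<^sub>M borel"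
    unfolding borel_prod[symmetric] by measurable
  then show "(\<lambda>(w, acc). (1 / real T) *\<^sub>R acc) \<in> dpsgd_traj W g eta v S T \<rightarrow>\<^sub>M borel"
    by (subst measurable_cong_sets[OF sets refl])
qed

end

lemma finite_measure_dpsgd: "finite_measure (dpsgd W g eta v S T)"
proof -
  interpret prob_space "dpsgd_traj W g eta v S T"
    using dpsgd_traj_in_prob_algebra[of S T] by (simp add: space_prob_algebra)
  have sets: "sets (dpsgd_traj W g eta v S T) = sets borel"
    using dpsgd_traj_in_prob_algebra[of S T] by (simp add: space_prob_algebra)
  have "(\<lambda>(w, acc). (1 / real T) *\<^sub>R acc) \<in> (borel :: ('a \<times> 'a) measure) \<rightarrow>\<^sub>M borel"
    unfolding borel_prod[symmetric] by measurable
  then have "(\<lambda>(w, acc). (1 / real T) *\<^sub>R acc) \<in> dpsgd_traj W g eta v S T \<rightarrow>\<^sub>M borel"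
    by (subst measurable_cong_sets[OF sets refl])
  then show ?thesis unfolding dpsgd_def by (rule finite_measure_distr)
qed

end

theorem theorem4:
  fixes W :: "'a::euclidean_space set"
    and X :: "'a set" and Y :: "real set"
    and f :: "'a \<Rightarrow> ('a \<times> real) \<Rightarrow> ('a \<times> real) \<Rightarrow> real"
    and g :: "'a \<Rightarrow> ('a \<times> real) \<Rightarrow> ('a \<times> real) \<Rightarrow> 'a"
    and eta :: "nat \<Rightarrow> real"
    and G \<beta> \<epsilon> \<delta> \<sigma>sq lam :: real
    and n T :: nat
  assumes W_convex: "convex W" and W_closed: "closed W" and W_zero: "0 \<in> W"
    and f_convex: "\<And>z z'. z \<in> X \<times> Y \<Longrightarrow> z' \<in> X \<times> Y \<Longrightarrow> convex_on W (\<lambda>w. f w z z')"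
    and f_lipschitz: "\<And>z z'. z \<in> X \<times> Y \<Longrightarrow> z' \<in> X \<times> Y \<Longrightarrow> G-lipschitz_on W (\<lambda>w. f w z z')"
    and g_subgrad: "\<And>z z' w v. z \<in> X \<times> Y \<Longrightarrow> z' \<in> X \<times> Y \<Longrightarrow> w \<in> W \<Longrightarrow> v \<in> W \<Longrightarrow>
                      f v z z' \<ge> f w z z' + g w z z' \<bullet> (v - w)"
    and g_bound: "\<And>z z' w. z \<in> X \<times> Y \<Longrightarrow> z' \<in> X \<times> Y \<Longrightarrow> w \<in> W \<Longrightarrow> norm (g w z z') \<le> G"
    and g_meas: "\<And>z z'. (\<lambda>w. g w z z') \<in> borel_measurable borel"
    and n_ge: "n \<ge> 2" and T_ge: "T \<ge> 1"
    and beta: "0 < \<beta>" "\<beta> < 1" and eps: "0 < \<epsilon>" and delta: "0 < \<delta>" "\<delta> < 1"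
    and sigma_def: "\<sigma>sq = 56 * G\<^sup>2 * real T / (\<beta> * (real n)\<^sup>2 * \<epsilon>)
                          * (ln (1 / \<delta>) / ((1 - \<beta>) * \<epsilon>) + 1)"
    and lambda_def: "lam = ln (1 / \<delta>) / ((1 - \<beta>) * \<epsilon>) + 1"
    and sigma_large: "\<sigma>sq \<ge> 2.68 * G\<^sup>2"
    and lambda_cond: "lam - 1 \<le> \<sigma>sq / (6 * G\<^sup>2)
                         * ln (real n / (2 * lam * (1 + \<sigma>sq / (4 * G\<^sup>2))))"
  shows "differentially_private (\<lambda>S. dpsgd W g eta \<sigma>sq S T) (X \<times> Y) n \<epsilon> \<delta>"
  unfolding differentially_private_def
proof (intro allI impI ballI)
  fix S S' :: "('a \<times> real) list" and E
  assume S: "set S \<subseteq> X \<times> Y" "set S' \<subseteq> X \<times> Y" and nb: "neighbouring n S S'"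
    and E: "E \<in> sets (dpsgd W g eta \<sigma>sq S T)"
  have len: "length S = n" "length S' = n" using nb by (auto simp: neighbouring_def)
  obtain m where m': "{i. i < n \<and> S ! i \<noteq> S' ! i} = {m}"
    using nb by (auto simp: neighbouring_def card_1_singleton_iff)
  then have m: "m < n" by auto
  have eq: "S ! i = S' ! i" if "i < n" "i \<noteq> m" for i using m' that by blast
  have mem: "S ! i \<in> X \<times> Y" "S' ! i \<in> X \<times> Y" if "i < n" for i
    using that len by (intro subsetD[OF S(1)] subsetD[OF S(2)] nth_mem; simp)+
  have lam: "1 < lam" using beta eps delta by (simp add: lambda_def)
  have "0 \<le> G" by (rule order_trans[OF norm_ge_zero g_bound[OF mem(1)[OF m] mem(1)[OF m] W_zero]])
  \<comment> \<open>For G = 0 the quotient \<open>\<sigma>sq / (6 * G\<^sup>2)\<close> is 0 by the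
    convention for division by zero, and the condition on \<open>lam\<close> would contradict lam >
    1.\<close>
  moreover have "G \<noteq> 0" using lambda_cond lam by (intro notI) simp
  ultimately have G: "0 < G" by simp
  have "0 < 2.68 * G\<^sup>2" using G by simp
  then have v: "0 < \<sigma>sq" using sigma_large by linarith
  \<comment> \<open>s is the squared maximal distance (2 G)^2 of two gradients over the noise
    variance; p is the probability that a sampled pair contains the changed index.\<close>
  define s p where "s = 4 * G\<^sup>2 / \<sigma>sq" and "p = 2 / real n"
  have s0: "0 < s" using G v by (simp add: s_def)
  have "4 * G\<^sup>2 \<le> 1.4926 * (2.68 * G\<^sup>2)" by simp
  also have "\<dots> \<le> 1.4926 * \<sigma>sq" using sigma_large by (intro mult_left_mono) auto
  finally have s1: "s \<le> 1.4926" using v by (simp add: s_def pos_divide_le_eq)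
  have n0: "0 < real n" using n_ge by simp
  define x where "x = real n / (2 * lam * (1 + \<sigma>sq / (4 * G\<^sup>2)))"
  have x0: "0 < x" using n0 lam v G by (simp add: x_def add_pos_pos)
  \<comment> \<open>In this form the argument of the logarithm is the ratio of s / (1 + s) to lam p,
    so exponentiating the hypothesis gives the sampling condition.\<close>
  have x_eq: "x = s / (1 + s) / (lam * p)"
  proof -
    have "s / (1 + s) = 1 / (1 + \<sigma>sq / (4 * G\<^sup>2))"
      using v G by (simp add: s_def field_simps)
    then show ?thesis using n0 by (simp add: x_def p_def)
  qed
  have sG: "\<sigma>sq / (6 * G\<^sup>2) = 2 / (3 * s)" using v G by (simp add: s_def)
  have "lam - 1 \<le> 2 / (3 * s) * ln x" using lambda_cond unfolding sG x_def .
  then have lnx: "1.5 * s * (lam - 1) \<le> ln x" using s0 by (simp add: field_simps)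
  then have "exp (1.5 * s * (lam - 1)) \<le> x" by (simp only: ln_ge_iff[OF x0])
  moreover have lp: "0 < lam * p" using lam n0 by (simp add: p_def)
  ultimately have cond: "lam * p * exp (1.5 * s * (lam - 1)) \<le> s / (1 + s)"
    unfolding x_eq pos_le_divide_eq[OF lp] by (simp only: mult.commute)
  \<comment> \<open>Since lam > 1 the logarithm must be positive; hence x > 1, which forces n > 2
    and thus p < 1.\<close>
  have "0 < 1.5 * s * (lam - 1)" using s0 lam by simp
  with lnx have "0 < ln x" by linarith
  then have "1 < x" using ln_gt_zero_iff[OF x0] by simp
  then have "1 * (2 * lam * (1 + \<sigma>sq / (4 * G\<^sup>2))) < real n"
    unfolding x_def using lam v G by (subst (asm) pos_less_divide_eq) (auto intro!: mult_pos_pos add_pos_pos)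
  moreover have "2 * 1 * 1 \<le> 2 * lam * (1 + \<sigma>sq / (4 * G\<^sup>2))"
    using lam v by (intro mult_mono) auto
  ultimately have n: "2 < n" by linarith
  have diam: "(a - b) \<bullet> (a - b) \<le> s * \<sigma>sq" if "norm a \<le> G" "norm b \<le> G" for a b :: 'a
  proof -
    have "norm (a - b) \<le> 2 * G" using norm_triangle_ineq4[of a b] that by linarith
    then have "(norm (a - b))\<^sup>2 \<le> (2 * G)\<^sup>2" by (intro power_mono) auto
    then show ?thesis using v by (simp add: s_def power2_norm_eq_inner power_mult_distrib)
  qed
  have bound: "norm (g w (S ! i) (S ! j)) \<le> G" "norm (g w (S' ! i) (S' ! j)) \<le> G"
    if "w \<in> W" "i < n" "j < n" for w i j
    using g_bound[OF mem(1)[OF that(2)] mem(1)[OF that(3)] that(1)]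
      g_bound[OF mem(2)[OF that(2)] mem(2)[OF that(3)] that(1)] by simp_all
  have "Holder_dominated (lam / (lam - 1)) (exp (3.5 * p\<^sup>2 * (lam - 1) * s) ^ T)
      (dpsgd W g eta \<sigma>sq S T) (dpsgd W g eta \<sigma>sq S' T)"
  proof (rule dpsgd_Holder_dominated[OF W_convex W_closed W_zero g_meas v n len m eq _ s0 s1 p_def lam cond])
    fix w i j k l
    assume "w \<in> W" "i < n" "j < n" "k < n" "l < n"
    then show "\<forall>x \<in> {g w (S ! i) (S ! j), g w (S' ! i) (S' ! j)}. \<forall>y \<in> {g w (S ! k) (S ! l), g w (S' ! k) (S' ! l)}.
        (x - y) \<bullet> (x - y) \<le> s * \<sigma>sq"
      by (auto intro!: diam bound)
  qed
  \<comment> \<open>As 3.5 * (2/n)^2 * 4 G^2 / \<sigma>^2 equals 56 G^2 / (n^2 \<sigma>^2), the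
    variance is exactly the one for which T steps at order lam cost \<beta> \<epsilon>.\<close>
  moreover have "exp (3.5 * p\<^sup>2 * (lam - 1) * s) ^ T = exp ((lam - 1) / lam * (\<beta> * \<epsilon>))"
  proof -
    have "\<beta> * \<epsilon> = 56 * G\<^sup>2 * real T * lam / ((real n)\<^sup>2 * \<sigma>sq)"
    proof -
      have "\<sigma>sq * (\<beta> * (real n)\<^sup>2 * \<epsilon>) = 56 * G\<^sup>2 * real T * lam"
        unfolding sigma_def lambda_def[symmetric] using beta eps n0 by simp
      then show ?thesis using v n0 by (simp add: field_simps)
    qed
    also have "\<dots> = real T * (3.5 * p\<^sup>2 * lam * s)" by (simp add: p_def s_def power_divide)
    finally have eq: "\<beta> * \<epsilon> = real T * (3.5 * p\<^sup>2 * lam * s)" .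
    have "(lam - 1) / lam * (\<beta> * \<epsilon>) = real T * (3.5 * p\<^sup>2 * (lam - 1) * s)"
      unfolding eq using lam by simp
    then show ?thesis by (simp only: exp_of_nat_mult)
  qed
  ultimately have dom: "Holder_dominated (lam / (lam - 1)) (exp ((lam - 1) / lam * (\<beta> * \<epsilon>)))
      (dpsgd W g eta \<sigma>sq S T) (dpsgd W g eta \<sigma>sq S' T)" by simp
  have fin: "finite_measure (dpsgd W g eta \<sigma>sq R T)" for R
    by (rule finite_measure_dpsgd[OF W_convex W_closed W_zero g_meas v])
  have "\<beta> * \<epsilon> + ln (1 / \<delta>) / (lam - 1) = \<epsilon>"
  proof -
    have "ln (1 / \<delta>) / (lam - 1) = (1 - \<beta>) * \<epsilon>"
      using delta beta eps by (simp add: lambda_def)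
    then show ?thesis by (simp add: algebra_simps)
  qed
  with Holder_dominated_measure[OF lam delta(1) dom E _ fin fin]
  show "measure (dpsgd W g eta \<sigma>sq S T) E \<le> exp \<epsilon> * measure (dpsgd W g eta \<sigma>sq S' T) E + \<delta>"
    by (simp add: dpsgd_def)
qed

end
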